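(* Let $(R_0,\mathfrak m)$ be an Artinian local equicharacteristic ring, $H:\mathbb N\to\mathbb N$ a function, $b\ge 1$ an integer and $R=R_0[X_1,\dots,X_b]$ with the standard grading. For every $n\ge 0$ consider the Euclidean division $$H(n)=\binom{n+b-1}{b-1}q(n)+r(n),\qquad 0\le r(n)<\binom{n+b-1}{b-1}.$$ Then the following conditions are equivalent: (i) There exists a homogeneous ideal $I\subseteq R_+$ such that $H=H_{R/I}$. (ii) $H(0)=\lambda_{R_0}(R_0)$ and $H(n+1)\le \binom{n+1+b-1}{b-1}q(n)+(r(n)_n)^+_+$ for all $n\ge 0$.
   Context: $\mathbb N$ includes $0$. A local ring is equicharacteristic if it has the same characteristic as its residue field. $\lambda_{R_0}$ denotes length of $R_0$-modules. $R=\bigoplus_{n\ge0}R_n$ with $\deg X_i=1$ and $R_+=\bigoplus_{n\ge 1}R_n$. The Hilbert function of $R/I$ is $H_{R/I}(n)=\lambda_{R_0}(R_n/I_n)$. Binomial operator: for integers $n,d\ge 1$ there are unique integers $k_d>k_{d-1}>\dots>k_\delta\ge\delta\ge1$ with $n=\binom{k_d}{d}+\binom{k_{d-1}}{d-1}+\dots+\binom{k_\delta}{\delta}$ (the $d$-binomial expansion of $n$). Define $(n_d)^+_+=\binom{k_d+1}{d+1}+\binom{k_{d-1}+1}{d}+\dots+\binom{k_\delta+1}{\delta+1}$, and $(0_d)^+_+=0$ for all $d$. For $n=0$ in the theorem one has $r(0)=0$, and $(0_0)^+_+$ is read as $0$. *)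

theory Defs
  imports "HOL-Algebra.Algebra" "HOL-Algebra.Algebraic_Closure_Type"
    "HOL-Library.Poly_Mapping" "HOL-Library.Extended_Nat"
begin

section \<open>Artinian local equicharacteristic rings\<close>

definition local_ring_with :: "('a, 'c) ring_scheme \<Rightarrow> 'a set \<Rightarrow> bool" where
  "local_ring_with R m \<longleftrightarrow>
     cring R \<and> maximalideal m R \<and> (\<forall>J. maximalideal J R \<longrightarrow> J = m)"

definition artinian_ring :: "('a, 'c) ring_scheme \<Rightarrow> bool" where
  "artinian_ring R \<longleftrightarrow>
     ring R \<and> (\<forall>J :: nat \<Rightarrow> 'a set. (\<forall>n. ideal (J n) R) \<longrightarrow> (\<forall>n. J (Suc n) \<subseteq> J n) \<longrightarrow>
                 (\<exists>N. \<forall>n\<ge>N. J n = J N))"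

text \<open>The additive order of the unit; \<open>group.ord\<close> is \<open>0\<close> for elements of infinite order.\<close>

definition ring_characteristic :: "('a, 'c) ring_scheme \<Rightarrow> nat" where
  "ring_characteristic R = group.ord (add_monoid R) \<one>\<^bsub>R\<^esub>"

definition equicharacteristic :: "('a, 'c) ring_scheme \<Rightarrow> 'a set \<Rightarrow> bool" where
  "equicharacteristic R m \<longleftrightarrow> ring_characteristic R = ring_characteristic (R Quot m)"

section \<open>Quotient modules and length\<close>

text \<open>
  The record type of modules extends that of rings; the fields \<open>mult\<close> and \<open>one\<close> play no role
  for a module and are left unspecified below.
\<close>

definition regular_module :: "('a, 'c) ring_scheme \<Rightarrow> ('a, 'a) module" where
  "regular_module R =
     \<lparr>carrier = carrier R, monoid.mult = undefined, one = undefined,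
      ring.zero = \<zero>\<^bsub>R\<^esub>, add = add R, module.smult = monoid.mult R\<rparr>"

definition quotient_module ::
    "('a, 'b, 'c) module_scheme \<Rightarrow> 'b set \<Rightarrow> ('a, 'b set) module" where
  "quotient_module M N =
     \<lparr>carrier = a_rcosets\<^bsub>M\<^esub> N, monoid.mult = undefined, one = undefined,
      ring.zero = N, add = set_add M,
      module.smult = (\<lambda>a A. \<Union>x\<in>A. N +>\<^bsub>M\<^esub> (a \<odot>\<^bsub>M\<^esub> x))\<rparr>"

text \<open>The length of a module: the supremum of the lengths of its strict chains of submodules.\<close>

definition module_length ::
    "('a, 'c) ring_scheme \<Rightarrow> ('a, 'b, 'd) module_scheme \<Rightarrow> enat" where
  "module_length R M =
     Sup {enat k | k. \<exists>C :: nat \<Rightarrow> 'b set.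
            (\<forall>i\<le>k. submodule (C i) R M) \<and> (\<forall>i<k. C i \<subset> C (Suc i))}"

section \<open>The graded ring \<open>R\<^sub>0[X\<^sub>1, \<dots>, X\<^sub>b]\<close>\<close>

text \<open>
  The coefficient ring is a type \<open>'a\<close> of class \<open>comm_ring_1\<close>, viewed as a ring record through
  \<open>ring_of_type_algebra\<close>.  A monomial is a finitely supported exponent vector
  \<open>nat \<Rightarrow>\<^sub>0 nat\<close>, and a polynomial a finitely supported coefficient function on monomials.
  The variables \<open>X\<^sub>1, \<dots>, X\<^sub>b\<close> are those with index \<open>0, \<dots>, b - 1\<close>.
\<close>

type_synonym 'a mpoly = "(nat \<Rightarrow>\<^sub>0 nat) \<Rightarrow>\<^sub>0 'a"

definition mpoly_ring :: "nat \<Rightarrow> 'a::comm_ring_1 mpoly ring" where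
  "mpoly_ring b =
     ring_of_type_algebra\<lparr>carrier := {p. \<forall>t\<in>Poly_Mapping.keys p. Poly_Mapping.keys t \<subseteq> {..<b}}\<rparr>"

definition monom_degree :: "(nat \<Rightarrow>\<^sub>0 nat) \<Rightarrow> nat" where
  "monom_degree t = (\<Sum>i\<in>Poly_Mapping.keys t. Poly_Mapping.lookup t i)"

definition graded_piece :: "nat \<Rightarrow> nat \<Rightarrow> 'a::comm_ring_1 mpoly set" where
  "graded_piece b n =
     {p \<in> carrier (mpoly_ring b). \<forall>t\<in>Poly_Mapping.keys p. monom_degree t = n}"

text \<open>The \<open>R\<^sub>0\<close>-module \<open>R\<^sub>n\<close>; scalars act through the constant polynomials.\<close>

definition graded_piece_module :: "nat \<Rightarrow> nat \<Rightarrow> ('a::comm_ring_1, 'a mpoly) module" where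
  "graded_piece_module b n =
     \<lparr>carrier = graded_piece b n, monoid.mult = undefined, one = undefined,
      ring.zero = 0, add = (+), module.smult = (\<lambda>a p. Poly_Mapping.single 0 a * p)\<rparr>"

definition positive_part :: "nat \<Rightarrow> 'a::comm_ring_1 mpoly set" where
  "positive_part b =
     {p \<in> carrier (mpoly_ring b). \<forall>t\<in>Poly_Mapping.keys p. 1 \<le> monom_degree t}"

definition homogeneous_component :: "nat \<Rightarrow> 'a::comm_ring_1 mpoly \<Rightarrow> 'a mpoly" where
  "homogeneous_component n p =
     (\<Sum>t\<in>{t \<in> Poly_Mapping.keys p. monom_degree t = n}.
        Poly_Mapping.single t (Poly_Mapping.lookup p t))"

definition homogeneous_ideal :: "nat \<Rightarrow> 'a::comm_ring_1 mpoly set \<Rightarrow> bool" where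
  "homogeneous_ideal b I \<longleftrightarrow>
     ideal I (mpoly_ring b) \<and> (\<forall>p\<in>I. \<forall>n. homogeneous_component n p \<in> I)"

definition hilbert_function :: "nat \<Rightarrow> 'a::comm_ring_1 mpoly set \<Rightarrow> nat \<Rightarrow> enat" where
  "hilbert_function b I n =
     module_length (ring_of_type_algebra :: 'a ring)
       (quotient_module (graded_piece_module b n) (I \<inter> graded_piece b n))"

section \<open>The binomial operator\<close>

text \<open>\<open>n = (k\<^sub>d choose d) + \<dots> + (k\<^sub>\<delta> choose \<delta>)\<close> with \<open>k\<^sub>d > \<dots> > k\<^sub>\<delta> \<ge> \<delta> \<ge> 1\<close>.\<close>

definition binomial_expansion :: "nat \<Rightarrow> nat \<Rightarrow> nat \<Rightarrow> (nat \<Rightarrow> nat) \<Rightarrow> bool" where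
  "binomial_expansion n d \<delta> k \<longleftrightarrow>
     1 \<le> \<delta> \<and> \<delta> \<le> d \<and> \<delta> \<le> k \<delta> \<and> (\<forall>i\<in>{\<delta>..<d}. k i < k (Suc i)) \<and>
     n = (\<Sum>i=\<delta>..d. k i choose i)"

text \<open>
  \<open>(n\<^sub>d)\<^sup>+\<^sub>+\<close>.  The description determines a value only for \<open>n = 0\<close> or \<open>d \<ge> 1\<close>.
\<close>

definition binomial_up :: "nat \<Rightarrow> nat \<Rightarrow> nat" where
  "binomial_up n d =
     (if n = 0 then 0
      else THE v. \<exists>\<delta> k. binomial_expansion n d \<delta> k \<and>
             v = (\<Sum>i=\<delta>..d. (k i + 1) choose (i + 1)))"

end

theory Submission
  imports Defs
begin

text \<open>
  Order the monomials of degree \<open>n\<close> by a monomial order and let \<open>c\<^sub>t\<close> be the ideal of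
  \<open>R\<^sub>0\<close> of leading coefficients at \<open>t\<close> of elements of \<open>I\<^sub>n\<close>.  Filtering \<open>R\<^sub>n / I\<^sub>n\<close> by leading monomials gives
  \<open>H(n) = \<Sum>\<^sub>t h(t)\<close> with \<open>h(t) = \<lambda>(R\<^sub>0 / c\<^sub>t)\<close>, and \<open>h\<close> decreases along multiplication by variables.
  The layers \<open>{t. h(t) > j}\<close> are therefore order ideals of monomials, each of which obeys Macaulay's bound;
  the bounds add up to condition (ii) because the Macaulay operator, extended to all numbers
  through division by the number of monomials, is superadditive.

  Conversely, if \<open>(C\<^sub>i)\<close> is a composition series of \<open>R\<^sub>0\<close> of length \<open>l\<close>, one takes for \<open>I\<close> the polynomials whose
  coefficient at \<open>t\<close> lies in \<open>C\<^bsub>l - h(t)\<^esub>\<close>, where \<open>h(t)\<close> is \<open>q(n) + 1\<close> on the last \<open>r(n)\<close> monomials of degree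
  \<open>n\<close> and \<open>q(n)\<close> on the others.
\<close>

section \<open>The Macaulay operator\<close>

text \<open>Superadditivity alone does not sustain an induction on the degree. When both summands
  are at most the leading binomial coefficient of \<open>s + t\<close>, a second inequality of
  convexity type is needed: two numbers below \<open>N = j choose n\<close> may be spread apart to
  \<open>N\<close> and the rest without decreasing the sum of the operator. Both are proved
  together. The second one is needed again in the division by the number of monomials, where it pays
  for the carry when two remainders reach the divisor. For the converse, condition (ii) forces
  \<open>q\<close> to be nonincreasing, because the Macaulay term stays below the number of
  monomials of the next degree. So the weights can fail to decrease only where \<open>q\<close> is
  constant, and there two final segments have to be compared. After one use of the correspondence
  theorem, the length of a quotient is the length of an interval of submodules; in such an interval
  monomials can be adjoined one at a time.\<close>

text \<open>Greedy form of the binomial expansion. It is total: for argument 0 the greedy index in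
  degree \<open>Suc n\<close> is \<open>n\<close>, which contributes 0.\<close>

fun macaulay_op :: "nat \<Rightarrow> nat \<Rightarrow> nat" where
  "macaulay_op 0 s = 0"
| "macaulay_op (Suc n) s =
     (let k = (GREATEST k. k choose Suc n \<le> s)
      in (Suc k choose Suc (Suc n)) + macaulay_op n (s - (k choose Suc n)))"

lemmas [simp del] = macaulay_op.simps(2)

text \<open>Bounds the set over which \<open>GREATEST\<close> is taken.\<close>

lemma choose_Suc_ge_diff: "k - n \<le> k choose Suc n"
proof (induction k)
  case (Suc k)
  show ?case
  proof (cases "n \<le> k")
    case True
    then have "0 < k choose n" by simp
    moreover have "Suc k choose Suc n = (k choose n) + (k choose Suc n)"
      by simp
    ultimately show ?thesis using Suc True by linarith
  qed simp
qed simp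

text \<open>By Pascal's rule the next coefficient \<open>Suc k choose Suc n\<close> exceeds the
  argument by \<open>(k choose n) - y\<close>, so \<open>k\<close> is the greedy index.\<close>

lemma macaulay_op_rec:
  assumes "y < k choose n"
  shows "macaulay_op (Suc n) ((k choose Suc n) + y) =
           (Suc k choose Suc (Suc n)) + macaulay_op n y"
proof -
  have "(GREATEST j. j choose Suc n \<le> (k choose Suc n) + y) = k"
  proof (rule Greatest_equality)
    fix j assume j: "j choose Suc n \<le> (k choose Suc n) + y"
    show "j \<le> k"
    proof (rule ccontr)
      assume "\<not> j \<le> k"
      then have "Suc k choose Suc n \<le> j choose Suc n"
        by (intro binomial_right_mono) simp
      then show False using j assms by simp
    qed
  qed simp
  then show ?thesis by (simp add: macaulay_op.simps(2) Let_def)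
qed

lemma macaulay_decomposition:
  obtains k y where "s = (k choose Suc n) + y" "y < k choose n"
proof -
  let ?P = "\<lambda>j. j choose Suc n \<le> s"
  have bd: "\<forall>j. ?P j \<longrightarrow> j \<le> n + s"
    using choose_Suc_ge_diff[of _ n] by (metis le_diff_conv le_trans add.commute)
  have "?P n" by (simp add: binomial_eq_0)
  then have k: "?P (GREATEST j. ?P j)" using GreatestI_nat[of ?P n "n + s"] bd by blast
  define k where "k = (GREATEST j. ?P j)"
  have "\<not> ?P (Suc k)"
    using Greatest_le_nat[of ?P "Suc k" "n + s"] bd unfolding k_def by fastforce
  then have "s - (k choose Suc n) < k choose n"
    using k by (simp add: k_def)
  then show thesis using that[of k "s - (k choose Suc n)"] k by (simp add: k_def)
qed

lemma macaulay_op_0 [simp]: "macaulay_op n 0 = 0"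
proof (induction n)
  case (Suc n)
  then show ?case using macaulay_op_rec[of 0 n n] by (simp add: binomial_eq_0)
qed simp

lemma macaulay_op_binomial:
  "macaulay_op (Suc n) (k choose Suc n) = Suc k choose Suc (Suc n)"
proof (cases "n \<le> k")
  case True
  then show ?thesis using macaulay_op_rec[of 0 k n] by simp
qed (simp add: binomial_eq_0)

text \<open>At the boundary value of \<open>y\<close> the greedy index jumps to
  \<open>Suc k\<close>, but Pascal's rule makes both evaluations agree. In degree 1 this would fail,
  since \<open>macaulay_op 0\<close> is constantly 0. A closed range of numbers thus shares one
  leading index, on which the later case distinctions rely.\<close>

lemma macaulay_op_rec_le:
  assumes "y \<le> k choose Suc n"
  shows "macaulay_op (Suc (Suc n)) ((k choose Suc (Suc n)) + y) =
           (Suc k choose Suc (Suc (Suc n))) + macaulay_op (Suc n) y"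
proof (cases "y = k choose Suc n")
  case True
  have "(k choose Suc (Suc n)) + y = Suc k choose Suc (Suc n)"
    using True by simp
  then have "macaulay_op (Suc (Suc n)) ((k choose Suc (Suc n)) + y) = Suc (Suc k) choose Suc (Suc (Suc n))"
    by (metis macaulay_op_binomial)
  then show ?thesis using True
    by (simp add: macaulay_op_binomial)
next
  case False
  then show ?thesis using assms macaulay_op_rec[of y k "Suc n"] by simp
qed

lemma macaulay_op_1: "macaulay_op (Suc 0) s = Suc s choose 2"
  using macaulay_op_binomial[of 0 s] by (simp add: numeral_2_eq_2)

text \<open>\<open>s\<close> and \<open>Suc s\<close> can be evaluated with the same leading index,
  even if the greedy index of \<open>Suc s\<close> is larger, so the claim descends to the
  remainders.\<close>

lemma macaulay_op_less_Suc: "macaulay_op (Suc n) s < macaulay_op (Suc n) (Suc s)"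
proof (induction n arbitrary: s)
  case 0
  then show ?case by (simp add: macaulay_op_1 numeral_2_eq_2)
next
  case (Suc n)
  obtain k y where s: "s = (k choose Suc (Suc n)) + y" and y: "y < k choose Suc n"
    by (rule macaulay_decomposition)
  have "Suc s = (k choose Suc (Suc n)) + Suc y" using s by simp
  with y show ?case
    using macaulay_op_rec_le[of "Suc y" k n] macaulay_op_rec_le[of y k n] Suc[of y]
    by (simp add: s)
qed

lemma strict_mono_macaulay_op: "strict_mono (macaulay_op (Suc n))"
  by (simp add: strict_mono_Suc_iff macaulay_op_less_Suc)

lemma macaulay_op_mono: "s \<le> t \<Longrightarrow> macaulay_op (Suc n) s \<le> macaulay_op (Suc n) t"
  using strict_mono_macaulay_op strict_mono_less_eq by blast

lemma macaulay_op_add_le: "macaulay_op (Suc n) s + t \<le> macaulay_op (Suc n) (s + t)"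
proof (induction t)
  case (Suc t)
  then show ?case using macaulay_op_less_Suc[of n "s + t"] by simp
qed simp

lemma le_macaulay_op: "s \<le> macaulay_op (Suc n) s"
  using macaulay_op_add_le[of n 0 s] by simp

text \<open>
  List the monomials of degree \<open>n\<close> in decreasing lexicographic order, weighting each by the number of
  new multiples it contributes in degree \<open>n + 1\<close>.  Then \<open>macaulay_op n s\<close> is the total weight of the last
  \<open>s\<close> monomials, superadditivity says that a block of consecutive monomials weighs at least as much
  as the last block of the same size, and the following property that, among all \<open>j choose n\<close> monomials
  in \<open>j + 1 - n\<close> variables, it weighs at most as much as the first one.
\<close>

definition binomial_subadd :: "nat \<Rightarrow> nat \<Rightarrow> bool" where
  "binomial_subadd n j \<longleftrightarrow> (\<forall>x y z. x \<le> j choose n \<longrightarrow> y \<le> j choose n \<longrightarrow> x + y = (j choose n) + z \<longrightarrow>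
     macaulay_op n x + macaulay_op n y \<le> macaulay_op n (j choose n) + macaulay_op n z)"

lemma binomial_subaddD:
  assumes "binomial_subadd n j" "N = j choose n" "x \<le> N" "y \<le> N" "x + y = N + z"
  shows "macaulay_op n x + macaulay_op n y \<le> macaulay_op n N + macaulay_op n z"
  using assms unfolding binomial_subadd_def by blast

text \<open>The leading terms are compared by induction, the remainder is evaluated in degree
  \<open>Suc n\<close> on both sides, and superadditivity recombines the two.\<close>

lemma macaulay_op_Suc_le:
  assumes superadd: "\<And>s t. macaulay_op (Suc n) s + macaulay_op (Suc n) t \<le> macaulay_op (Suc n) (s + t)"
  shows "macaulay_op (Suc (Suc n)) s \<le> macaulay_op (Suc n) s"
proof (induction s rule: less_induct)
  case (less s)
  obtain k y where s: "s = (k choose Suc (Suc n)) + y" and y: "y < k choose Suc n"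
    by (rule macaulay_decomposition)
  show ?case
  proof (cases "s = 0")
    case False
    define M where "M = k choose Suc (Suc n)"
    have e: "macaulay_op (Suc (Suc n)) s = macaulay_op (Suc (Suc n)) M + macaulay_op (Suc n) y"
      using macaulay_op_rec[OF y] by (simp add: s M_def macaulay_op_binomial)
    show ?thesis
    proof (cases "y = 0")
      case True
      \<comment> \<open>then \<open>s\<close> is itself a binomial coefficient and has a second decomposition\<close>
      then obtain k' where k': "k = Suc k'" using False s by (cases k) auto
      define x where "x = k' choose Suc n"
      have s': "s = (k' choose Suc (Suc n)) + x" using True s k' by (simp add: x_def)
      have e': "macaulay_op (Suc (Suc n)) s = macaulay_op (Suc (Suc n)) (k' choose Suc (Suc n)) + macaulay_op (Suc n) x"
        unfolding s' by (simp add: x_def macaulay_op_rec_le macaulay_op_binomial del: binomial_Suc_Suc)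
      have "0 < x" using False s k' True by (auto simp: x_def not_less_eq_eq)
      then show ?thesis using e' s' less[of "k' choose Suc (Suc n)"] superadd[of "k' choose Suc (Suc n)" x]
        by simp
    next
      case False
      then show ?thesis using e s less[of M] superadd[of M y] by (simp add: M_def)
    qed
  qed simp
qed

text \<open>If one summand contains the leading coefficient \<open>M\<close> of
  \<open>s + t\<close>, an inequality between remainders one degree lower is left. If both are at
  most \<open>M\<close>, \<open>binomial_subadd\<close> replaces them by \<open>M\<close> and
  \<open>y\<close>.\<close>

lemma macaulay_op_superadd_step:
  assumes superadd: "\<And>s t. macaulay_op (Suc n) s + macaulay_op (Suc n) t \<le> macaulay_op (Suc n) (s + t)"
    and sub: "\<And>j. binomial_subadd (Suc (Suc n)) j"
  shows "macaulay_op (Suc (Suc n)) s + macaulay_op (Suc (Suc n)) t \<le> macaulay_op (Suc (Suc n)) (s + t)"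
proof -
  obtain k y where st: "s + t = (k choose Suc (Suc n)) + y" and y: "y < k choose Suc n"
    by (rule macaulay_decomposition)
  define M where "M = k choose Suc (Suc n)"
  have e: "macaulay_op (Suc (Suc n)) (M + z) = macaulay_op (Suc (Suc n)) M + macaulay_op (Suc n) z"
    if "z \<le> y" for z
    using macaulay_op_rec[of z k "Suc n"] that y by (simp add: M_def macaulay_op_binomial)
  note pred = macaulay_op_Suc_le[OF superadd]
  have *: "macaulay_op (Suc (Suc n)) s + macaulay_op (Suc (Suc n)) t \<le> macaulay_op (Suc (Suc n)) (s + t)"
    if st: "s + t = M + y" and "M \<le> s" for s t
  proof -
    obtain z where z: "s = M + z" using \<open>M \<le> s\<close> le_Suc_ex by blast
    with st have "y = z + t" by simp
    with z e[of z] e[of y] superadd[of z t] pred[of t] st show ?thesis by (simp add: add.assoc)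
  qed
  consider "M \<le> s" | "M \<le> t" | "s \<le> M" "t \<le> M" by linarith
  then show ?thesis
  proof cases
    case 1 then show ?thesis using * st by (simp add: M_def)
  next
    case 2 then show ?thesis using *[of t s] st by (simp add: M_def add.commute)
  next
    case 3
    have "macaulay_op (Suc (Suc n)) s + macaulay_op (Suc (Suc n)) t
            \<le> macaulay_op (Suc (Suc n)) M + macaulay_op (Suc (Suc n)) y"
      using binomial_subaddD[OF sub[of k], of M s t y] 3 st by (simp add: M_def)
    also have "\<dots> \<le> macaulay_op (Suc (Suc n)) M + macaulay_op (Suc n) y" using pred by simp
    also have "\<dots> = macaulay_op (Suc (Suc n)) (s + t)" using e[of y] st by (simp add: M_def)
    finally show ?thesis .
  qed
qed

text \<open>In terms of monomials, \<open>M\<close> and \<open>K\<close> count those without and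
  with the largest variable; the first \<open>d\<close> of the former are to weigh at most as much
  as the first \<open>d\<close> of the latter.\<close>

lemma macaulay_op_top_block_le:
  fixes n j
  defines "M \<equiv> j choose Suc (Suc n)" and "K \<equiv> j choose Suc n"
  assumes superadd: "\<And>s t. macaulay_op (Suc n) s + macaulay_op (Suc n) t \<le> macaulay_op (Suc n) (s + t)"
    and sub: "binomial_subadd (Suc n) j"
    and sub': "binomial_subadd (Suc (Suc n)) j"
    and "d \<le> M" "d \<le> K"
  shows "macaulay_op (Suc (Suc n)) M + macaulay_op (Suc n) (K - d)
           \<le> macaulay_op (Suc n) K + macaulay_op (Suc (Suc n)) (M - d)"
  using \<open>d \<le> M\<close> \<open>d \<le> K\<close>
proof (induction d rule: less_induct)
  case (less d)
  show ?case
  proof (cases j)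
    case 0
    then show ?thesis using less.prems by (simp add: M_def K_def)
  next
    case (Suc i)
    define M1 where "M1 = i choose Suc (Suc n)"
    define K1 where "K1 = i choose Suc n"
    define L1 where "L1 = i choose n"
    have M: "M = M1 + K1" and K: "K = K1 + L1"
      by (simp_all add: M_def K_def M1_def K1_def L1_def Suc)
    have e: "macaulay_op (Suc (Suc n)) (M1 + z) = macaulay_op (Suc (Suc n)) M1 + macaulay_op (Suc n) z"
      if "z \<le> K1" for z
      using macaulay_op_rec_le[of z i n] that by (simp add: M1_def K1_def macaulay_op_binomial)
    show ?thesis
    proof (cases "d \<le> K1")
      case True
      \<comment> \<open>The first \<open>d\<close> monomials lie in the top block of
        \<open>M\<close>, of size \<open>K1\<close>, whose weights are those of degree
        \<open>Suc n\<close>. There they are compared with the top of \<open>K\<close>.\<close>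
      have "macaulay_op (Suc n) K1 + macaulay_op (Suc n) (K - d)
              \<le> macaulay_op (Suc n) K + macaulay_op (Suc n) (K1 - d)"
        by (rule binomial_subaddD[OF sub K_def[THEN meta_eq_to_obj_eq]])
          (use True less.prems K in auto)
      moreover have "M - d = M1 + (K1 - d)" using True M by simp
      ultimately show ?thesis using e[of K1] e[of "K1 - d"] M by simp
    next
      case False
      show ?thesis
      proof (cases "K1 = 0")
        case True
        then have "M = 0" by (auto simp: M M1_def K1_def)
        then show ?thesis using less.prems by simp
      next
        case False
        \<comment> \<open>The \<open>x\<close> monomials beyond the top block weigh at most as much
          as the first \<open>x\<close> of \<open>M\<close> (2), hence as the first \<open>x\<close>
          of \<open>K\<close> (3). The next \<open>K1\<close> monomials of \<open>K\<close> weigh at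
          least \<open>macaulay_op (Suc n) K1\<close> (4), which is the weight of the top block of
          \<open>M\<close> (1).\<close>
        define x where "x = d - K1"
        have d: "d = K1 + x" using \<open>\<not> d \<le> K1\<close> by (simp add: x_def)
        have 1: "macaulay_op (Suc (Suc n)) M = macaulay_op (Suc (Suc n)) M1 + macaulay_op (Suc n) K1"
          using e[of K1] M by simp
        have 2: "macaulay_op (Suc (Suc n)) M1 + macaulay_op (Suc (Suc n)) (M - x)
             \<le> macaulay_op (Suc (Suc n)) M + macaulay_op (Suc (Suc n)) (M - d)"
          by (rule binomial_subaddD[OF sub' M_def[THEN meta_eq_to_obj_eq]])
            (use less.prems M d in auto)
        have 3: "macaulay_op (Suc (Suc n)) M + macaulay_op (Suc n) (K - x)
           \<le> macaulay_op (Suc n) K + macaulay_op (Suc (Suc n)) (M - x)"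
          by (rule less.IH) (use less.prems d False in auto)
        have "K - x = K1 + (K - d)" using d less.prems by simp
        then have 4: "macaulay_op (Suc n) K1 + macaulay_op (Suc n) (K - d) \<le> macaulay_op (Suc n) (K - x)"
          using superadd[of K1 "K - d"] by simp
        from 1 2 3 4 show ?thesis by linarith
      qed
    qed
  qed
qed


text \<open>The range up to \<open>M + K\<close> has a lower block \<open>M\<close>, weighed in
  degree \<open>Suc (Suc n)\<close>, and an upper block \<open>K\<close>, weighed in degree
  \<open>Suc n\<close>. The cases record the blocks of \<open>x\<close> and \<open>y\<close>;
  \<open>first\<close> exchanges the top of the lower block for the top of the upper one.\<close>

lemma binomial_subadd_step:
  assumes superadd: "\<And>s t. macaulay_op (Suc n) s + macaulay_op (Suc n) t \<le> macaulay_op (Suc n) (s + t)"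
    and sub: "binomial_subadd (Suc n) j"
    and sub': "binomial_subadd (Suc (Suc n)) j"
  shows "binomial_subadd (Suc (Suc n)) (Suc j)"
proof -
  define M where "M = j choose Suc (Suc n)"
  define K where "K = j choose Suc n"
  let ?F = "macaulay_op (Suc (Suc n))" and ?G = "macaulay_op (Suc n)"
  have e: "?F (M + z) = ?F M + ?G z" if "z \<le> K" for z
    using macaulay_op_rec_le[of z j n] that by (simp add: M_def K_def macaulay_op_binomial)
  have first: "?F M + ?G (K - d) \<le> ?G K + ?F (M - d)" if "d \<le> M" "d \<le> K" for d
    using macaulay_op_top_block_le[OF superadd sub sub'] that by (simp add: M_def K_def)
  note subM = binomial_subaddD[OF sub' M_def]
  note subK = binomial_subaddD[OF sub K_def]
  have N: "Suc j choose Suc (Suc n) = M + K" by (simp add: M_def K_def)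
  have main: "?F x + ?F y \<le> ?F (M + K) + ?F z"
    if xy: "x \<le> y" "y \<le> M + K" "x + y = M + K + z" for x y z
  proof -
    consider "y \<le> M" | "x \<le> M" "M \<le> y" | "M \<le> x" using xy by linarith
    then show ?thesis
    proof cases
      case 1
      then have "K + z \<le> M" "K \<le> M" using xy by auto
      \<comment> \<open>The first spreading fills \<open>M\<close> and leaves \<open>K + z\<close>.
        The second, with \<open>M - K\<close> as partner, reduces \<open>K + z\<close> to
        \<open>z\<close>, at the cost of the first \<open>K\<close> monomials of the lower
        block.\<close>
      have "?F x + ?F y \<le> ?F M + ?F (K + z)"
        using subM[of x y "K + z"] 1 xy by simp
      moreover have "?F (K + z) + ?F (M - K) \<le> ?F M + ?F z"
        using subM[of "K + z" "M - K" z] \<open>K + z \<le> M\<close> by simp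
      moreover have "?F M \<le> ?G K + ?F (M - K)"
        using first[of K] \<open>K \<le> M\<close> by simp
      ultimately show ?thesis using e[of K] by simp
    next
      case 2
      define y' where "y' = y - M"
      have y: "y = M + y'" "y' \<le> K" using 2 xy by (auto simp: y'_def)
      \<comment> \<open>\<open>d\<close> is what \<open>y\<close> lacks to be all of
        \<open>M + K\<close>; it is the excess of \<open>x\<close> over \<open>z\<close>.\<close>
      define d where "d = K - y'"
      have d: "x = z + d" "d \<le> K" "d \<le> M" "y' = K - d" using y xy 2 by (auto simp: d_def)
      have "?F x + ?F (M - d) \<le> ?F M + ?F z"
        using subM[of x "M - d" z] 2 d by simp
      then show ?thesis using first[of d] e[of y'] e[of K] y d by simp
    next
      case 3
      define x' y' where "x' = x - M" and "y' = y - M"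
      have x: "x = M + x'" "x' \<le> K" and y: "y = M + y'" "y' \<le> K"
        using 3 xy by (auto simp: x'_def y'_def)
      show ?thesis
      proof (cases "M \<le> z")
        case True
        define z' where "z' = z - M"
        have z: "z = M + z'" using True by (simp add: z'_def)
        have "z' \<le> K" using x y z xy by simp
        moreover have "?G x' + ?G y' \<le> ?G K + ?G z'"
          using subK[of x' y' z'] x y z xy by simp
        ultimately show ?thesis using e[of x'] e[of y'] e[of z'] e[of K] x y z by simp
      next
        case False
        \<comment> \<open>Together \<open>x'\<close> and \<open>y'\<close> fit into the upper block
          and leave \<open>d\<close> places free, so superadditivity applies and
          \<open>first\<close> makes up for the deficit of \<open>z\<close> below
          \<open>M\<close>.\<close>
        define d where "d = M - z"
        have d: "d \<le> M" "d \<le> K" "M - d = z" "x' + y' = K - d" using False x y xy by (auto simp: d_def)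
        then show ?thesis using first[of d] superadd[of x' y'] e[of x'] e[of y'] e[of K] x y by simp
      qed
    qed
  qed
  show ?thesis
    unfolding binomial_subadd_def N
  proof (intro allI impI)
    fix x y z assume *: "x \<le> M + K" "y \<le> M + K" "x + y = M + K + z"
    show "?F x + ?F y \<le> ?F (M + K) + ?F z"
      using main[of x y z] main[of y x z] * by (cases "x \<le> y") (simp_all add: add.commute)
  qed
qed

lemma macaulay_op_1_Suc: "macaulay_op (Suc 0) (Suc s) = Suc s + macaulay_op (Suc 0) s"
  by (simp add: macaulay_op_1 numeral_2_eq_2)

lemma macaulay_op_1_add: "macaulay_op (Suc 0) (s + t) = macaulay_op (Suc 0) s + macaulay_op (Suc 0) t + s * t"
  by (induction t) (simp_all add: macaulay_op_1_Suc)

text \<open>In a new degree \<open>binomial_subadd\<close> comes first, by an inner induction on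
  \<open>j\<close> that uses both statements of the old degree; superadditivity then follows from
  it.\<close>

lemma macaulay_superadd_and_binomial_subadd:
  "(\<forall>s t. macaulay_op (Suc n) s + macaulay_op (Suc n) t \<le> macaulay_op (Suc n) (s + t)) \<and>
   (\<forall>j. binomial_subadd (Suc n) j)"
proof (induction n)
  case 0
  have "macaulay_op (Suc 0) x + macaulay_op (Suc 0) y \<le> macaulay_op (Suc 0) N + macaulay_op (Suc 0) z"
    if *: "x \<le> N" "y \<le> N" "x + y = N + z" for x y z N
  proof -
    \<comment> \<open>In degree 1 the two sides differ by \<open>u * (x - z)\<close>.\<close>
    define u where "u = N - x"
    have "N = x + u" "y = u + z" using * by (auto simp: u_def)
    moreover then have "z \<le> x" using * by simp
    ultimately show ?thesis by (simp add: macaulay_op_1_add)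
  qed
  then show ?case by (auto simp: macaulay_op_1_add binomial_subadd_def)
next
  case (Suc n)
  have sub: "binomial_subadd (Suc (Suc n)) j" for j
  proof (induction j)
    case 0
    show ?case by (simp add: binomial_subadd_def)
  next
    case (Suc j)
    then show ?case using binomial_subadd_step Suc.IH \<open>_ \<and> _\<close> by blast
  qed
  then show ?case using macaulay_op_superadd_step Suc.IH by blast
qed

lemma macaulay_op_superadd:
  "macaulay_op (Suc n) s + macaulay_op (Suc n) t \<le> macaulay_op (Suc n) (s + t)"
  and binomial_subadd: "binomial_subadd (Suc n) j"
  using macaulay_superadd_and_binomial_subadd by blast+

text \<open>
  The inductive step of Macaulay's theorem: splitting by divisibility by one variable, \<open>x\<close> and \<open>y\<close> count
  the monomials that are and are not divisible by it.  In degree 1 the term \<open>macaulay_op 0 x\<close> has to be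
  read as infinite for \<open>x > 0\<close>.
\<close>

lemma macaulay_op_split_1:
  "(if x = 0 then 0 else x + y) + macaulay_op (Suc 0) y \<le> macaulay_op (Suc 0) (x + y)"
proof (cases x)
  case (Suc u)
  have "macaulay_op (Suc 0) y \<le> macaulay_op (Suc 0) (u + y)" by (rule macaulay_op_mono) simp
  then show ?thesis using Suc macaulay_op_1_Suc[of "u + y"] by simp
qed simp

text \<open>The minimum combines two bounds for the multiples of the variable: after division they
  lie in a set of size \<open>x + y\<close>, and they obey Macaulay's bound one degree lower. The
  first bound alone would fail for \<open>x = 0\<close>, the second in general for
  \<open>y = 0\<close>. The proof locates \<open>y\<close> relative to \<open>M1\<close> and
  \<open>M\<close>, where \<open>M\<close> is the leading coefficient of
  \<open>x + y\<close>.\<close>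

lemma macaulay_op_split:
  "min (x + y) (macaulay_op (Suc n) x) + macaulay_op (Suc (Suc n)) y \<le> macaulay_op (Suc (Suc n)) (x + y)"
proof (induction n arbitrary: x y rule: less_induct)
  case (less n)
  let ?F = "macaulay_op (Suc (Suc n))" and ?G = "macaulay_op (Suc n)"
  obtain k z where s: "x + y = (k choose Suc (Suc n)) + z" and z: "z < k choose Suc n"
    by (rule macaulay_decomposition)
  define M where "M = k choose Suc (Suc n)"
  define K where "K = k choose Suc n"
  have e: "?F (M + w) = ?F M + ?G w" if "w \<le> K" for w
    using macaulay_op_rec_le[of w k n] that by (simp add: M_def K_def macaulay_op_binomial)
  have FM: "?F M = M + (k choose Suc (Suc (Suc n)))"
    by (simp add: M_def K_def macaulay_op_binomial)
  show ?case
  proof (cases "M \<le> y")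
    case True
    then obtain w where w: "y = M + w" using le_Suc_ex by blast
    then have xw: "z = x + w" using s by (simp add: M_def)
    have "x + y = M + z" using s by (simp add: M_def)
    then have "?F (x + y) = ?F M + ?G (x + w)" using e[of z] z xw by (simp only: K_def)
    then show ?thesis using xw z w e[of w] macaulay_op_superadd[of n x w]
      by (simp add: M_def K_def)
  next
    case False
    then obtain i where i: "k = Suc i" by (cases k) (auto simp: M_def)
    define M1 where "M1 = i choose Suc (Suc n)"
    define K1 where "K1 = i choose Suc n"
    define L1 where "L1 = i choose n"
    have M: "M = M1 + K1" and K: "K = K1 + L1"
      by (simp_all add: M_def K_def M1_def K1_def L1_def i)
    show ?thesis
    proof (cases "M1 \<le> y")
      case False
      \<comment> \<open>For small \<open>y\<close> the bound \<open>x + y\<close> suffices, since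
        \<open>?F M\<close> exceeds \<open>M\<close> by exactly \<open>?F M1\<close>.\<close>
      have "?F y \<le> ?F M1" using False by (intro macaulay_op_mono) simp
      also have "\<dots> = k choose Suc (Suc (Suc n))" by (simp add: M1_def macaulay_op_binomial i)
      finally have "?F y \<le> k choose Suc (Suc (Suc n))" .
      then have "x + y + ?F y \<le> ?F M + ?G z"
        using FM s le_macaulay_op[of z n] by (simp add: M_def)
      then show ?thesis using e[of z] s z by (simp add: M_def K_def)
    next
      case True
      define y' where "y' = y - M1"
      have y: "y = M1 + y'" "y' < K1" using True \<open>\<not> M \<le> y\<close> M by (auto simp: y'_def)
      have xy: "x + y' = K1 + z" using s y M by (simp add: M_def)
      have Fy: "?F y = ?F M1 + ?G y'"
        using macaulay_op_rec_le[of y' i n] y by (simp add: M1_def K1_def macaulay_op_binomial)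
      have FM': "?F M = ?F M1 + ?G K1"
        using macaulay_op_rec_le[of K1 i n] M by (simp add: M1_def K1_def macaulay_op_binomial)
      have Fs: "?F (x + y) = ?F M + ?G z" using e[of z] s z by (simp add: M_def K_def)
      show ?thesis
      proof (cases "x \<le> K1")
        case True
        then have "?G x + ?G y' \<le> ?G K1 + ?G z"
          using binomial_subaddD[OF binomial_subadd K1_def, of x y' z] xy y by simp
        then show ?thesis using Fy FM' Fs by simp
      next
        case False
        \<comment> \<open>With \<open>M1\<close> removed from \<open>y\<close> and \<open>K1\<close>
          from \<open>x\<close>, the same kind of inequality is left one degree lower, for the total
          \<open>z = u + y'\<close>.\<close>
        define u where "u = x - K1"
        have u: "x = K1 + u" "u + y' = z" "u \<noteq> 0" using False xy by (auto simp: u_def)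
        have GK1: "?G K1 = M" by (simp add: K1_def macaulay_op_binomial M_def i)
        show ?thesis
        proof (cases n)
          case 0
          have "z + ?G y' \<le> ?G z" using macaulay_op_split_1[of u y'] u 0 by simp
          then show ?thesis using Fy FM' Fs GK1 s by (simp add: M_def)
        next
          case (Suc n')
          have IH: "min z (macaulay_op n u) + ?G y' \<le> ?G z"
            using less[of n' u y'] u Suc by simp
          show ?thesis
          proof (cases "z \<le> macaulay_op n u")
            case True
            then show ?thesis using IH Fy FM' Fs GK1 s by (simp add: M_def)
          next
            case False
            \<comment> \<open>A larger \<open>u\<close> would have a Macaulay bound of at least
              \<open>K\<close>, hence above \<open>z\<close>. So \<open>x\<close> can be evaluated
              with leading term \<open>K1\<close>.\<close>
            have "u \<le> L1"
            proof (rule ccontr)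
              assume "\<not> u \<le> L1"
              then have "macaulay_op n L1 \<le> macaulay_op n u" unfolding Suc by (intro macaulay_op_mono) simp
              moreover have "macaulay_op n L1 = K" by (simp add: L1_def K_def Suc i macaulay_op_binomial)
              ultimately show False using False z by (simp add: K_def)
            qed
            then have "?G x = ?G K1 + macaulay_op n u"
              using macaulay_op_rec_le[of u i n'] u by (simp add: K1_def L1_def Suc macaulay_op_binomial)
            then show ?thesis using IH False Fy FM' Fs by simp
          qed
        qed
      qed
    qed
  qed
qed

section \<open>Macaulay's bound for order ideals of monomials\<close>

text \<open>The second conjunct carries the induction: the lower terms stay below
  \<open>k (Suc d) choose d\<close>, so the top index of any expansion is the greedy one. Hence all
  expansions of \<open>s\<close> give the same value.\<close>

lemma binomial_expansion_value:
  assumes "binomial_expansion s d \<delta> k"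
  shows "(\<Sum>i=\<delta>..d. (k i + 1) choose (i + 1)) = macaulay_op d s \<and> s < Suc (k d) choose d"
  using assms
proof (induction d arbitrary: s)
  case 0
  then show ?case unfolding binomial_expansion_def by linarith
next
  case (Suc d)
  note exp = Suc.prems[unfolded binomial_expansion_def]
  show ?case
  proof (cases "\<delta> = Suc d")
    case True
    then show ?thesis using exp by (auto simp: macaulay_op_binomial)
  next
    case False
    define s' where "s' = (\<Sum>i=\<delta>..d. k i choose i)"
    have "\<delta> \<le> d" using False exp by simp
    then have IH: "(\<Sum>i=\<delta>..d. (k i + 1) choose (i + 1)) = macaulay_op d s'" "s' < Suc (k d) choose d"
      using Suc.IH[of s'] exp by (auto simp: binomial_expansion_def s'_def)
    have "k d < k (Suc d)" using exp \<open>\<delta> \<le> d\<close> by simp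
    then have "Suc (k d) choose d \<le> k (Suc d) choose d" by (intro binomial_right_mono) simp
    then have s': "s' < k (Suc d) choose d" using IH by simp
    have s: "s = (k (Suc d) choose Suc d) + s'"
      using exp \<open>\<delta> \<le> d\<close> by (simp add: s'_def)
    show ?thesis
      using IH(1) s' \<open>\<delta> \<le> d\<close> by (simp add: s macaulay_op_rec)
  qed
qed

lemma binomial_expansion_exists:
  assumes "0 < s"
  shows "\<exists>\<delta> k. binomial_expansion s (Suc d) \<delta> k"
  using assms
proof (induction d arbitrary: s)
  case 0
  then have "binomial_expansion s 1 1 (\<lambda>_. s)" by (simp add: binomial_expansion_def)
  then show ?case by auto
next
  case (Suc d)
  obtain K y where s: "s = (K choose Suc (Suc d)) + y" and y: "y < K choose Suc d"
    by (rule macaulay_decomposition)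
  show ?case
  proof (cases "y = 0")
    case True
    then have "Suc (Suc d) \<le> K" using s Suc.prems by (metis add.right_neutral zero_less_binomial_iff)
    then have "binomial_expansion s (Suc (Suc d)) (Suc (Suc d)) (\<lambda>_. K)"
      using s True by (simp add: binomial_expansion_def)
    then show ?thesis by blast
  next
    case False
    then obtain \<delta> k where k: "binomial_expansion y (Suc d) \<delta> k" using Suc.IH by blast
    note exp = k[unfolded binomial_expansion_def]
    \<comment> \<open>A single term of the expansion of \<open>y\<close> is at most
      \<open>y\<close>; this keeps its top index below \<open>K\<close>.\<close>
    have "k (Suc d) choose Suc d \<le> y"
      using exp by (simp add: sum.atLeast_Suc_atMost sum.cl_ivl_Suc)
    then have "k (Suc d) < K" using y binomial_right_mono[of K "k (Suc d)" "Suc d"] by linarith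
    have "(\<Sum>i=\<delta>..Suc d. (k(Suc (Suc d) := K)) i choose i) = y"
      using exp by (auto intro!: sum.cong)
    then have "(\<Sum>i=\<delta>..Suc (Suc d). (k(Suc (Suc d) := K)) i choose i) = s"
      using exp s by simp
    then have "binomial_expansion s (Suc (Suc d)) \<delta> (k(Suc (Suc d) := K))"
      using exp \<open>k (Suc d) < K\<close> less_Suc_eq_le[of _ "Suc d"] unfolding binomial_expansion_def
      by (auto simp: less_Suc_eq_le)
    then show ?thesis by blast
  qed
qed

lemma binomial_up_eq: "binomial_up s (Suc n) = macaulay_op (Suc n) s"
proof (cases "s = 0")
  case False
  obtain \<delta> k where "binomial_expansion s (Suc n) \<delta> k"
    using binomial_expansion_exists[of s n] False by blast
  then have "(THE v. \<exists>\<delta> k. binomial_expansion s (Suc n) \<delta> k \<and>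
               v = (\<Sum>i=\<delta>..Suc n. (k i + 1) choose (i + 1))) = macaulay_op (Suc n) s"
    using binomial_expansion_value[of s "Suc n"] by (intro the_equality) metis+
  then show ?thesis using False by (simp only: binomial_up_def if_False)
qed (simp add: binomial_up_def)

section \<open>Monomials of a given degree\<close>

abbreviation var :: "nat \<Rightarrow> (nat \<Rightarrow>\<^sub>0 nat)" where
  "var i \<equiv> Poly_Mapping.single i (Suc 0)"

lemma monom_degree_eq_sum:
  assumes "finite A" "Poly_Mapping.keys t \<subseteq> A"
  shows "monom_degree t = (\<Sum>i\<in>A. Poly_Mapping.lookup t i)"
  unfolding monom_degree_def using assms
  by (intro sum.mono_neutral_left) (auto simp: in_keys_iff)

lemma keys_plus_nat:
  "Poly_Mapping.keys (s + t) = Poly_Mapping.keys s \<union> Poly_Mapping.keys (t :: 'x \<Rightarrow>\<^sub>0 nat)"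
  by (auto simp: in_keys_iff lookup_add)

lemma monom_degree_add [simp]: "monom_degree (s + t) = monom_degree s + monom_degree t"
proof -
  let ?A = "Poly_Mapping.keys s \<union> Poly_Mapping.keys t"
  show ?thesis
    using monom_degree_eq_sum[of ?A s] monom_degree_eq_sum[of ?A t] monom_degree_eq_sum[of ?A "s + t"]
    by (simp add: keys_plus_nat lookup_add sum.distrib)
qed

lemma monom_degree_single [simp]: "monom_degree (Poly_Mapping.single i k) = k"
  by (simp add: monom_degree_def)

lemma monom_degree_zero [simp]: "monom_degree 0 = 0"
  by (simp add: monom_degree_def)

lemma monom_degree_eq_0_iff [simp]: "monom_degree t = 0 \<longleftrightarrow> t = 0"
  unfolding monom_degree_def by (auto simp: in_keys_iff intro!: poly_mapping_eqI)

definition monomials :: "nat \<Rightarrow> nat \<Rightarrow> (nat \<Rightarrow>\<^sub>0 nat) set" where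
  "monomials b n = {t. Poly_Mapping.keys t \<subseteq> {..<b} \<and> monom_degree t = n}"

lemma add_var_in_monomials_iff:
  "t + var i \<in> monomials b (Suc n) \<longleftrightarrow> t \<in> monomials b n \<and> i < b"
  by (auto simp: monomials_def keys_plus_nat)

lemma monomials_0: "monomials b 0 = {0}"
  by (auto simp: monomials_def)

lemma monomials_no_vars: "monomials 0 (Suc n) = {}"
  by (auto simp: monomials_def monom_degree_def)

lemma var_divides:
  assumes "Poly_Mapping.lookup t i \<noteq> 0"
  obtains u where "t = u + var i"
proof
  show "t = (t - var i) + var i"
    using assms by (intro poly_mapping_eqI) (auto simp: lookup_add lookup_minus lookup_single when_def)
qed

lemma monomials_SucE:
  assumes "t \<in> monomials b (Suc n)"
  obtains i u where "i < b" "t = u + var i" "u \<in> monomials b n"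
proof -
  have "t \<noteq> 0" using assms by (auto simp: monomials_def)
  then obtain i where i: "Poly_Mapping.lookup t i \<noteq> 0" by (metis lookup_zero poly_mapping_eqI)
  then obtain u where u: "t = u + var i" by (rule var_divides)
  show thesis using that[of i u] u assms by (simp add: add_var_in_monomials_iff)
qed

lemma monomials_mono: "monomials b n \<subseteq> monomials (Suc b) n"
  by (auto simp: monomials_def)

lemma in_monomials_Suc_iff:
  "t \<in> monomials (Suc b) n \<and> Poly_Mapping.lookup t b = 0 \<longleftrightarrow> t \<in> monomials b n"
proof -
  have "Poly_Mapping.keys t \<subseteq> {..<b}" if "Poly_Mapping.keys t \<subseteq> {..<Suc b}" "Poly_Mapping.lookup t b = 0"
    using that by (metis in_keys_iff lessThan_Suc subset_insert)
  then show ?thesis by (auto simp: monomials_def in_keys_iff)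
qed

lemma monomials_Suc_Suc:
  "monomials (Suc b) (Suc n) = monomials b (Suc n) \<union> (\<lambda>u. u + var b) ` monomials (Suc b) n"
proof (intro subset_antisym subsetI)
  fix t assume t: "t \<in> monomials (Suc b) (Suc n)"
  show "t \<in> monomials b (Suc n) \<union> (\<lambda>u. u + var b) ` monomials (Suc b) n"
  proof (cases "Poly_Mapping.lookup t b = 0")
    case True
    then show ?thesis using t in_monomials_Suc_iff by blast
  next
    case False
    then obtain u where "t = u + var b" by (rule var_divides)
    then show ?thesis using t by (auto simp: add_var_in_monomials_iff)
  qed
qed (use monomials_mono in \<open>auto simp: add_var_in_monomials_iff\<close>)

lemma add_var_notin_monomials: "u + var b \<notin> monomials b n"
  by (auto simp: monomials_def keys_plus_nat)

lemma finite_card_monomials: "finite (monomials b n) \<and> card (monomials b n) = (b + n - 1) choose n"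
proof (induction b arbitrary: n)
  case 0
  then show ?case by (cases n) (auto simp: monomials_0 monomials_no_vars)
next
  case (Suc b)
  note outer = Suc
  show ?case
  proof (induction n)
    case 0
    then show ?case by (simp add: monomials_0)
  next
    case (Suc n)
    have "card (monomials (Suc b) (Suc n)) =
            card (monomials b (Suc n)) + card ((\<lambda>u. u + var b) ` monomials (Suc b) n)"
      unfolding monomials_Suc_Suc using Suc outer add_var_notin_monomials
      by (intro card_Un_disjoint) auto
    also have "card ((\<lambda>u. u + var b) ` monomials (Suc b) n) = card (monomials (Suc b) n)"
      by (rule card_image) (simp add: inj_on_def)
    finally show ?case using Suc outer[of "Suc n"] by (simp add: monomials_Suc_Suc)
  qed
qed

lemma finite_monomials [simp]: "finite (monomials b n)"
  and card_monomials: "card (monomials b n) = (b + n - 1) choose n"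
  using finite_card_monomials by auto

lemma macaulay_op_card_monomials:
  "macaulay_op (Suc n) (card (monomials b (Suc n))) = card (monomials b (Suc (Suc n)))"
  by (simp add: card_monomials macaulay_op_binomial del: binomial_Suc_Suc)

section \<open>Macaulay's bound by splitting off the last variable\<close>

lemma card_split_last_var:
  assumes "S \<subseteq> monomials (Suc b) (Suc n)"
  shows "card S = card {u. u + var b \<in> S} + card (S \<inter> monomials b (Suc n))"
proof -
  have S: "S = (\<lambda>u. u + var b) ` {u. u + var b \<in> S} \<union> (S \<inter> monomials b (Suc n))"
    using assms by (auto simp: monomials_Suc_Suc)
  have fin: "finite S" using assms by (rule finite_subset) simp
  have "card S = card ((\<lambda>u. u + var b) ` {u. u + var b \<in> S}) + card (S \<inter> monomials b (Suc n))"
    by (subst S, rule card_Un_disjoint)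
      (use fin add_var_notin_monomials in \<open>auto intro: finite_subset[OF _ fin]\<close>)
  then show ?thesis by (simp add: card_image inj_on_def)
qed

text \<open>Double induction on the number of variables and the degree. Monomials of
  \<open>T\<close> free of the last variable fall under the outer induction. The others, divided by
  it, lie in \<open>S\<close> and also obey the bound one degree lower against \<open>?S1\<close>;
  this is the minimum in \<open>macaulay_op_split\<close>.\<close>

theorem macaulay_bound:
  assumes "S \<subseteq> monomials b (Suc n)" "T \<subseteq> monomials b (Suc (Suc n))"
    and "\<And>t i. t + var i \<in> T \<Longrightarrow> t \<in> S"
  shows "card T \<le> macaulay_op (Suc n) (card S)"
  using assms
proof (induction b arbitrary: n S T)
  case 0
  then show ?case by (simp add: monomials_no_vars)
next
  case (Suc b)
  note outer = Suc.IH
  show ?case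
    using Suc.prems
  proof (induction n arbitrary: S T)
    case (0 S T)
    let ?S1 = "{u. u + var b \<in> S}" and ?S0 = "S \<inter> monomials b (Suc 0)"
    let ?T1 = "{u. u + var b \<in> T}" and ?T0 = "T \<inter> monomials b (Suc (Suc 0))"
    have fin: "finite S" using 0 by (meson finite_monomials finite_subset)
    have S: "card S = card ?S1 + card ?S0" using 0 by (intro card_split_last_var)
    have T: "card T = card ?T1 + card ?T0" using 0 by (intro card_split_last_var)
    have T0: "card ?T0 \<le> macaulay_op (Suc 0) (card ?S0)"
      using 0 by (intro outer) (auto simp: add_var_in_monomials_iff)
    have fin1: "finite ?S1" using fin by (auto intro: finite_vimageI[unfolded vimage_def] simp: inj_def)
    have "?T1 \<subseteq> S" using 0 by auto
    \<comment> \<open>Here \<open>?S1\<close> has degree 0 and no inner bound exists. Instead,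
      removing a variable of \<open>t\<close> rather than the factor \<open>var b\<close> gives a
      multiple of \<open>var b\<close> in \<open>S\<close>.\<close>
    moreover have "?S1 \<noteq> {}" if "?T1 \<noteq> {}"
    proof -
      from that obtain t where t: "t + var b \<in> T" by auto
      then have "t \<in> monomials (Suc b) (Suc 0)" using 0 by (auto simp: add_var_in_monomials_iff)
      then obtain i u where "t = u + var i" by (rule monomials_SucE)
      then have "(u + var b) + var i \<in> T" using t by (simp add: ac_simps)
      then show ?thesis using 0(3) by blast
    qed
    ultimately have "card ?T1 \<le> (if card ?S1 = 0 then 0 else card ?S1 + card ?S0)"
      using fin1 fin S card_mono[of S ?T1] by (cases "?T1 = {}") auto
    then show ?case using S T T0 macaulay_op_split_1[of "card ?S1" "card ?S0"] by simp
  next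
    case (Suc n S T)
    let ?S1 = "{u. u + var b \<in> S}" and ?S0 = "S \<inter> monomials b (Suc (Suc n))"
    let ?T1 = "{u. u + var b \<in> T}" and ?T0 = "T \<inter> monomials b (Suc (Suc (Suc n)))"
    have fin: "finite S" using Suc by (meson finite_monomials finite_subset)
    have S: "card S = card ?S1 + card ?S0" using Suc by (intro card_split_last_var)
    have T: "card T = card ?T1 + card ?T0" using Suc by (intro card_split_last_var)
    have T0: "card ?T0 \<le> macaulay_op (Suc (Suc n)) (card ?S0)"
      using Suc by (intro outer) (auto simp: add_var_in_monomials_iff)
    have "?T1 \<subseteq> S" using Suc by auto
    then have "card ?T1 \<le> card ?S1 + card ?S0" using card_mono[OF fin] S by metis
    moreover have "card ?T1 \<le> macaulay_op (Suc n) (card ?S1)"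
    proof (rule Suc.IH)
      show "t \<in> ?S1" if "t + var i \<in> ?T1" for t i
        using that Suc.prems(3)[of "t + var b" i] by (simp add: ac_simps)
    qed (use Suc.prems in \<open>auto simp: add_var_in_monomials_iff\<close>)
    ultimately show ?case using S T T0 macaulay_op_split[of "card ?S1" "card ?S0" n] by simp
  qed
qed

section \<open>The bound for weights on monomials\<close>

text \<open>The right-hand side of the growth condition as a function of \<open>a = H n\<close>
  alone, so that it can be applied to single layers and to their sums.\<close>

definition graded_macaulay_op :: "nat \<Rightarrow> nat \<Rightarrow> nat \<Rightarrow> nat" where
  "graded_macaulay_op b n a =
     card (monomials b (Suc n)) * (a div card (monomials b n)) + macaulay_op n (a mod card (monomials b n))"

text \<open>The quotient is 0 unless \<open>a\<close> counts all monomials. In that case it is 1,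
  and \<open>macaulay_op\<close> also takes the number of monomials to that of the next
  degree.\<close>

lemma graded_macaulay_op_eq:
  assumes "0 < b" "a \<le> card (monomials b (Suc n))"
  shows "graded_macaulay_op b (Suc n) a = macaulay_op (Suc n) a"
proof (cases "a = card (monomials b (Suc n))")
  case True
  have "0 < card (monomials b (Suc n))"
    using assms by (simp add: card_monomials)
  then have "a div card (monomials b (Suc n)) = 1" "a mod card (monomials b (Suc n)) = 0"
    using True by (metis div_self less_irrefl, metis mod_self)
  then show ?thesis
    using True by (simp add: graded_macaulay_op_def macaulay_op_card_monomials)
next
  case False
  then show ?thesis using assms by (simp add: graded_macaulay_op_def)
qed

text \<open>Without a carry this is superadditivity for the remainders. With a carry,
  \<open>binomial_subadd\<close> applies because the divisor \<open>N\<close> is a binomial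
  coefficient, and \<open>?F N = N'\<close> is what the increased quotient contributes.\<close>

lemma graded_macaulay_op_superadd:
  assumes "0 < b"
  shows "graded_macaulay_op b (Suc n) x + graded_macaulay_op b (Suc n) y \<le> graded_macaulay_op b (Suc n) (x + y)"
proof -
  define N where "N = card (monomials b (Suc n))"
  define N' where "N' = card (monomials b (Suc (Suc n)))"
  have N: "0 < N" using assms by (simp add: N_def card_monomials del: binomial_Suc_Suc)
  let ?F = "macaulay_op (Suc n)"
  have F: "graded_macaulay_op b (Suc n) a = N' * (a div N) + ?F (a mod N)" for a
    by (simp add: graded_macaulay_op_def N_def N'_def)
  define p r q s where "p = x div N" and "r = x mod N" and "q = y div N" and "s = y mod N"
  have x: "x = N * p + r" and y: "y = N * q + s" by (simp_all add: p_def r_def q_def s_def)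
  have rs: "r < N" "s < N" using N by (simp_all add: r_def s_def)
  have xy: "x + y = N * (p + q) + (r + s)" by (simp add: x y algebra_simps)
  show ?thesis
  proof (cases "r + s < N")
    case True
    then have "(x + y) div N = p + q" "(x + y) mod N = r + s" by (simp_all add: xy)
    then show ?thesis using macaulay_op_superadd[of n r s]
      by (simp add: F p_def q_def r_def s_def algebra_simps)
  next
    case False
    define z where "z = r + s - N"
    have z: "r + s = N + z" "z < N" using False rs by (auto simp: z_def)
    define k where "k = p + q + 1"
    have "x + y = N * k + z" using xy z by (simp add: k_def algebra_simps)
    then have "(x + y) div N = k" "(x + y) mod N = z" using z by simp_all
    moreover have "?F r + ?F s \<le> ?F N + ?F z"
      by (rule binomial_subaddD[OF binomial_subadd]) (use rs z in \<open>auto simp: N_def card_monomials\<close>)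
    moreover have "?F N = N'" by (simp add: N_def N'_def macaulay_op_card_monomials)
    ultimately show ?thesis
      by (simp add: F k_def algebra_simps flip: p_def q_def r_def s_def)
  qed
qed

lemma sum_eq_sum_card_layers:
  fixes h :: "'x \<Rightarrow> nat"
  assumes "finite A" "\<And>t. t \<in> A \<Longrightarrow> h t \<le> L"
  shows "sum h A = (\<Sum>j<L. card {t \<in> A. j < h t})"
proof -
  have "h t = (\<Sum>j<L. if j < h t then 1 else 0)" if "t \<in> A" for t
  proof -
    have "{j \<in> {..<L}. j < h t} = {..<h t}" using assms(2)[OF that] by auto
    then show ?thesis by (simp add: sum.If_cases Int_def)
  qed
  then have "sum h A = (\<Sum>t\<in>A. \<Sum>j<L. if j < h t then 1 else 0)" by (intro sum.cong) auto
  also have "\<dots> = (\<Sum>j<L. \<Sum>t\<in>A. if j < h t then 1 else 0)" by (rule sum.swap)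
  also have "\<dots> = (\<Sum>j<L. card {t \<in> A. j < h t})"
    using assms(1) by (intro sum.cong) (auto simp: sum.If_cases Int_def)
  finally show ?thesis .
qed

theorem macaulay_bound_weighted:
  assumes "0 < b"
    and mono: "\<And>t i. t \<in> monomials b (Suc n) \<Longrightarrow> i < b \<Longrightarrow> h (t + var i) \<le> h t"
  shows "sum h (monomials b (Suc (Suc n))) \<le> graded_macaulay_op b (Suc n) (sum h (monomials b (Suc n)))"
proof -
  let ?M = "monomials b (Suc n)" and ?M' = "monomials b (Suc (Suc n))"
  define L where "L = sum h ?M"
  have L: "h t \<le> L" if "t \<in> ?M" for t
    using that by (simp add: L_def member_le_sum)
  have L': "h t \<le> L" if t: "t \<in> ?M'" for t
  proof -
    obtain i u where "i < b" "t = u + var i" "u \<in> ?M" using t by (rule monomials_SucE)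
    then show ?thesis using mono[of u i] L[of u] by simp
  qed
  define S T where "S j = {t \<in> ?M. j < h t}" and "T j = {t \<in> ?M'. j < h t}" for j
  have layer: "card (T j) \<le> graded_macaulay_op b (Suc n) (card (S j))" for j
  proof -
    have "t \<in> S j" if "t + var i \<in> T j" for t i
      using that mono[of t i] by (auto simp: S_def T_def add_var_in_monomials_iff)
    then have "card (T j) \<le> macaulay_op (Suc n) (card (S j))"
      by (intro macaulay_bound[where b = b]) (auto simp: S_def T_def)
    also have "card (S j) \<le> card ?M" by (intro card_mono) (auto simp: S_def)
    then have "macaulay_op (Suc n) (card (S j)) = graded_macaulay_op b (Suc n) (card (S j))"
      using \<open>0 < b\<close> by (simp add: graded_macaulay_op_eq)
    finally show ?thesis .
  qed
  have "(\<Sum>j<l. card (T j)) \<le> graded_macaulay_op b (Suc n) (\<Sum>j<l. card (S j))" for l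
  proof (induction l)
    case (Suc l)
    then show ?case
      using layer[of l] graded_macaulay_op_superadd[OF \<open>0 < b\<close>, of n "\<Sum>j<l. card (S j)" "card (S l)"]
      by simp
  qed simp
  then show ?thesis
    using sum_eq_sum_card_layers[of ?M h L] sum_eq_sum_card_layers[of ?M' h L] L L'
    by (simp add: S_def T_def)
qed

section \<open>Final segments of monomials\<close>

text \<open>
  The last \<open>a\<close> monomials of degree \<open>n\<close> for the decreasing lexicographic order in which the variable of
  index \<open>b - 1\<close> is the largest.
\<close>

fun last_monomials :: "nat \<Rightarrow> nat \<Rightarrow> nat \<Rightarrow> (nat \<Rightarrow>\<^sub>0 nat) set" where
  "last_monomials b 0 a = (if a = 0 then {} else {0})"
| "last_monomials 0 (Suc n) a = {}"
| "last_monomials (Suc b) (Suc n) a =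
     (let c = card (monomials b (Suc n))
      in if a \<le> c then last_monomials b (Suc n) a
         else monomials b (Suc n) \<union> (\<lambda>u. u + var b) ` last_monomials (Suc b) n (a - c))"

lemmas [simp del] = last_monomials.simps(3)

lemma last_monomials_le:
  "a \<le> card (monomials b (Suc n)) \<Longrightarrow> last_monomials (Suc b) (Suc n) a = last_monomials b (Suc n) a"
  by (simp add: last_monomials.simps(3))

lemma last_monomials_gt:
  "card (monomials b (Suc n)) < a \<Longrightarrow> last_monomials (Suc b) (Suc n) a =
     monomials b (Suc n) \<union> (\<lambda>u. u + var b) ` last_monomials (Suc b) n (a - card (monomials b (Suc n)))"
  by (simp add: last_monomials.simps(3))

lemma last_monomials_subset: "last_monomials b n a \<subseteq> monomials b n"
proof (induction b n a rule: last_monomials.induct)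
  case (3 b n a)
  then show ?case
    using monomials_mono[of b "Suc n"]
    by (cases "a \<le> card (monomials b (Suc n))")
      (auto simp: last_monomials_le last_monomials_gt monomials_Suc_Suc)
qed (auto simp: monomials_0)

lemma card_monomials_Suc_Suc:
  "card (monomials (Suc b) (Suc n)) = card (monomials b (Suc n)) + card (monomials (Suc b) n)"
  by (simp add: card_monomials)

lemma card_last_monomials: "a \<le> card (monomials b n) \<Longrightarrow> card (last_monomials b n a) = a"
proof (induction b n a rule: last_monomials.induct)
  case (3 b n a)
  let ?c = "card (monomials b (Suc n))"
  show ?case
  proof (cases "a \<le> ?c")
    case False
    have fin: "finite (last_monomials (Suc b) n (a - ?c))"
      using last_monomials_subset finite_monomials by (rule finite_subset)
    have "card (monomials b (Suc n) \<union> (\<lambda>u. u + var b) ` last_monomials (Suc b) n (a - ?c)) =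
            ?c + card ((\<lambda>u. u + var b) ` last_monomials (Suc b) n (a - ?c))"
      using fin add_var_notin_monomials by (intro card_Un_disjoint) auto
    also have "\<dots> = ?c + card (last_monomials (Suc b) n (a - ?c))"
      by (simp add: card_image inj_on_def)
    also have "\<dots> = a" using 3 False by (simp add: card_monomials_Suc_Suc)
    finally show ?thesis using False by (simp add: last_monomials_gt)
  qed (use 3 in \<open>simp add: last_monomials_le\<close>)
qed (auto simp: monomials_0 monomials_no_vars)

lemma last_monomials_all: "last_monomials b n (card (monomials b n)) = monomials b n"
  by (intro card_subset_eq last_monomials_subset finite_monomials) (simp add: card_last_monomials)

lemma last_monomials_mono: "a \<le> a' \<Longrightarrow> last_monomials b n a \<subseteq> last_monomials b n a'"
proof (induction b n a arbitrary: a' rule: last_monomials.induct)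
  case (3 b n a)
  let ?c = "card (monomials b (Suc n))"
  consider "a' \<le> ?c" | "a \<le> ?c" "?c < a'" | "?c < a" by linarith
  then show ?case
  proof cases
    case 1
    then show ?thesis using 3 by (simp add: last_monomials_le)
  next
    case 2
    have "last_monomials b (Suc n) a \<subseteq> monomials b (Suc n)" by (rule last_monomials_subset)
    then show ?thesis using 2 by (simp add: last_monomials_le last_monomials_gt le_supI1)
  next
    case 3
    have "last_monomials (Suc b) n (a - ?c) \<subseteq> last_monomials (Suc b) n (a' - ?c)"
      using 3 "3.prems" by (intro "3.IH"(2)) auto
    then have "(\<lambda>u. u + var b) ` last_monomials (Suc b) n (a - ?c) \<subseteq>
               (\<lambda>u. u + var b) ` last_monomials (Suc b) n (a' - ?c)" by (rule image_mono)
    then show ?thesis using 3 "3.prems" by (simp only: last_monomials_gt less_le_trans) blast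
  qed
qed auto

text \<open>Each step from \<open>y\<close> up to \<open>k choose Suc n\<close> raises the operator
  by at least 1, and Pascal's rule splits its value at the top.\<close>

lemma macaulay_op_le_add_choose:
  assumes "y \<le> k choose Suc n"
  shows "macaulay_op (Suc n) y \<le> y + (k choose Suc (Suc n))"
proof -
  have "macaulay_op (Suc n) y + ((k choose Suc n) - y) \<le> Suc k choose Suc (Suc n)"
    using macaulay_op_add_le[of n y "(k choose Suc n) - y"] assms
    by (simp add: macaulay_op_binomial del: binomial_Suc_Suc)
  then show ?thesis using assms by simp
qed

text \<open>Sharpness of Macaulay's bound: final segments may grow by exactly the operator. Segments
  and operator split in the same way by the largest variable, \<open>a = ?c + y\<close> going to
  \<open>?c' + macaulay_op (Suc n) y\<close>.\<close>

lemma last_monomials_divisor: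
  assumes "a \<le> card (monomials b (Suc n))"
    and "t + var i \<in> last_monomials b (Suc (Suc n)) (macaulay_op (Suc n) a)"
  shows "t \<in> last_monomials b (Suc n) a"
  using assms
proof (induction b arbitrary: n a t)
  case 0
  then show ?case by simp
next
  case (Suc b)
  note outer = Suc.IH
  show ?case
    using Suc.prems
  proof (induction n arbitrary: a t)
    case 0
    let ?c = "card (monomials b (Suc 0))"
    have t: "t \<in> monomials (Suc b) (Suc 0)" "i < Suc b"
      using subsetD[OF last_monomials_subset 0(2)] by (auto simp: add_var_in_monomials_iff)
    show ?case
    proof (cases "a \<le> ?c")
      case True
      then have "macaulay_op (Suc 0) a \<le> card (monomials b (Suc (Suc 0)))"
        using macaulay_op_mono[OF True, of 0] by (simp add: macaulay_op_card_monomials)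
      then show ?thesis using 0 outer[of a 0 t] True by (simp add: last_monomials_le)
    next
      case False
      \<comment> \<open>In degree 1 only the largest variable lies outside
        \<open>monomials b\<close>, so the segment is everything.\<close>
      then have "a = card (monomials (Suc b) (Suc 0))" using 0 by (simp add: card_monomials_Suc_Suc monomials_0)
      then show ?thesis using t by (simp only: last_monomials_all)
    qed
  next
    case (Suc n)
    let ?c = "card (monomials b (Suc (Suc n)))"
    let ?c' = "card (monomials b (Suc (Suc (Suc n))))"
    show ?case
    proof (cases "a \<le> ?c")
      case True
      then have "macaulay_op (Suc (Suc n)) a \<le> ?c'"
        using macaulay_op_mono[OF True, of "Suc n"] by (simp add: macaulay_op_card_monomials)
      then show ?thesis using Suc.prems outer[of a "Suc n" t] True by (simp add: last_monomials_le)
    next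
      case False
      define y where "y = a - ?c"
      have y: "a = ?c + y" "0 < y" "y \<le> card (monomials (Suc b) (Suc n))"
        using False Suc.prems(1) by (auto simp: y_def card_monomials_Suc_Suc)
      \<comment> \<open>\<open>?c\<close> is \<open>(b + n + 1) choose Suc (Suc n)\<close>, so
        splitting it off is a step of the expansion, including the boundary case where
        \<open>a\<close> counts all monomials.\<close>
      have F: "macaulay_op (Suc (Suc n)) a = ?c' + macaulay_op (Suc n) y"
        using y macaulay_op_rec_le[of y "b + n + 1" n] by (simp add: card_monomials del: binomial_Suc_Suc)
      have pos: "0 < macaulay_op (Suc n) y" using y le_macaulay_op[of y n] by simp
      have "t + var i \<in> monomials b (Suc (Suc (Suc n))) \<or>
            t + var i \<in> (\<lambda>u. u + var b) ` last_monomials (Suc b) (Suc (Suc n)) (macaulay_op (Suc n) y)"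
        using Suc.prems(2) pos by (simp add: F last_monomials_gt)
      then show ?thesis
      proof
        assume "t + var i \<in> monomials b (Suc (Suc (Suc n)))"
        then show ?thesis using False by (simp add: last_monomials_gt add_var_in_monomials_iff)
      next
        assume "t + var i \<in> (\<lambda>u. u + var b) ` last_monomials (Suc b) (Suc (Suc n)) (macaulay_op (Suc n) y)"
        then obtain u where u: "t + var i = u + var b"
          "u \<in> last_monomials (Suc b) (Suc (Suc n)) (macaulay_op (Suc n) y)" by auto
        show ?thesis
        proof (cases "i = b")
          case True
          then have "t = u" using u by simp
          \<comment> \<open>Division by the largest variable stays in the segment of length
            \<open>macaulay_op (Suc n) y\<close>, which must not be longer than
            \<open>a\<close>.\<close>
          moreover have "macaulay_op (Suc n) y \<le> a"
            using macaulay_op_le_add_choose[of y "b + n + 1" n] y by (simp add: card_monomials del: binomial_Suc_Suc)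
          ultimately show ?thesis using u(2) last_monomials_mono by blast
        next
          case False
          \<comment> \<open>Division by a smaller variable keeps the factor \<open>var b\<close>;
            cancelling it leaves the claim one degree lower.\<close>
          have "Poly_Mapping.lookup t b = Poly_Mapping.lookup (u + var b) b"
            using u(1)[symmetric] False by (simp add: lookup_add lookup_single)
          then have "Poly_Mapping.lookup t b \<noteq> 0" by (simp add: lookup_add)
          then obtain v where v: "t = v + var b" by (rule var_divides)
          have "u + var b = (v + var i) + var b" using u(1) v by (simp add: ac_simps)
          then have "u = v + var i" by simp
          then have "v \<in> last_monomials (Suc b) (Suc n) y" using Suc.IH[of y v] u(2) y by simp
          then show ?thesis using v y \<open>\<not> a \<le> ?c\<close> by (simp add: last_monomials_gt)
        qed
      qed
    qed
  qed
qed

section \<open>Lengths of intervals of submodules\<close>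

text \<open>Stated for arbitrary families of sets, so that submodules of quotients, intervals of
  submodules and ideals are compared through strictly monotone maps alone.\<close>

definition chain_length :: "'x set set \<Rightarrow> enat" where
  "chain_length \<P> = Sup {enat k | k. \<exists>C. (\<forall>i\<le>k. C i \<in> \<P>) \<and> (\<forall>i<k. C i \<subset> C (Suc i))}"

lemma chain_length_ge:
  assumes "\<And>i. i \<le> k \<Longrightarrow> C i \<in> \<P>" "\<And>i. i < k \<Longrightarrow> C i \<subset> C (Suc i)"
  shows "enat k \<le> chain_length \<P>"
  unfolding chain_length_def using assms by (intro Sup_upper) blast

lemma chain_length_le:
  assumes "\<And>k C. (\<And>i. i \<le> k \<Longrightarrow> C i \<in> \<P>) \<Longrightarrow> (\<And>i. i < k \<Longrightarrow> C i \<subset> C (Suc i)) \<Longrightarrow> enat k \<le> l"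
  shows "chain_length \<P> \<le> l"
  unfolding chain_length_def using assms by (intro Sup_least) blast

text \<open>In \<open>enat\<close> a finite supremum of a nonempty set is a maximum; nonemptiness
  matters because the empty supremum is 0.\<close>

lemma chain_length_attained:
  assumes "chain_length \<P> = enat l" "\<P> \<noteq> {}"
  obtains C where "\<And>i. i \<le> l \<Longrightarrow> C i \<in> \<P>" "\<And>i. i < l \<Longrightarrow> C i \<subset> C (Suc i)"
proof -
  let ?A = "{enat k | k. \<exists>C. (\<forall>i\<le>k. C i \<in> \<P>) \<and> (\<forall>i<k. C i \<subset> C (Suc i))}"
  obtain P where "P \<in> \<P>" using assms(2) by blast
  then have "enat 0 \<in> ?A" by (auto intro!: exI[of _ "\<lambda>_. P"])
  then have "?A \<noteq> {}" by blast
  moreover have S: "Sup ?A = enat l" using assms(1) by (simp add: chain_length_def)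
  ultimately have "finite ?A" "Max ?A = enat l" unfolding Sup_enat_def by (auto split: if_splits)
  then have "enat l \<in> ?A" using \<open>?A \<noteq> {}\<close> Max_in[of ?A] by metis
  then show thesis using that by auto
qed

lemma chain_length_transfer:
  assumes "\<And>P. P \<in> \<P> \<Longrightarrow> f P \<in> \<Q>"
    and "\<And>P P'. P \<in> \<P> \<Longrightarrow> P' \<in> \<P> \<Longrightarrow> P \<subset> P' \<Longrightarrow> f P \<subset> f P'"
  shows "chain_length \<P> \<le> chain_length \<Q>"
proof (rule chain_length_le)
  fix k C assume "\<And>i. i \<le> k \<Longrightarrow> C i \<in> \<P>" "\<And>i. i < k \<Longrightarrow> C i \<subset> C (Suc i)"
  then show "enat k \<le> chain_length \<Q>"
    using assms by (intro chain_length_ge[of k "\<lambda>i. f (C i)"]) auto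
qed

lemma chain_length_mono: "\<P> \<subseteq> \<Q> \<Longrightarrow> chain_length \<P> \<le> chain_length \<Q>"
  by (rule chain_length_transfer[where f = "\<lambda>P. P"]) auto

lemma card_strict_steps_le_chain_length:
  assumes "\<And>i. i \<le> k \<Longrightarrow> D i \<in> \<P>" "\<And>i. i < k \<Longrightarrow> D i \<subseteq> D (Suc i)"
  shows "enat (card {i. i < k \<and> D i \<noteq> D (Suc i)}) \<le> chain_length \<P>"
proof -
  have "\<exists>C. let c = card {i. i < k \<and> D i \<noteq> D (Suc i)} in
          C c = D k \<and> (\<forall>i\<le>c. C i \<in> \<P>) \<and> (\<forall>i<c. C i \<subset> C (Suc i))"
    using assms
  proof (induction k)
    case 0
    then show ?case by (auto intro!: exI[of _ "\<lambda>_. D 0"])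
  next
    case (Suc k)
    define c where "c = card {i. i < k \<and> D i \<noteq> D (Suc i)}"
    have "\<exists>C. let c = card {i. i < k \<and> D i \<noteq> D (Suc i)} in
            C c = D k \<and> (\<forall>i\<le>c. C i \<in> \<P>) \<and> (\<forall>i<c. C i \<subset> C (Suc i))"
      by (rule Suc.IH) (use Suc.prems in simp_all)
    then obtain C where C: "C c = D k" "\<forall>i\<le>c. C i \<in> \<P>" "\<forall>i<c. C i \<subset> C (Suc i)"
      unfolding c_def Let_def by blast
    have set: "{i. i < Suc k \<and> D i \<noteq> D (Suc i)} =
       {i. i < k \<and> D i \<noteq> D (Suc i)} \<union> (if D k = D (Suc k) then {} else {k})"
      by (auto simp: less_Suc_eq)
    show ?case
    proof (cases "D k = D (Suc k)")
      case True
      then show ?thesis using C by (auto simp: set Let_def simp flip: c_def)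
    next
      case False
      then have "card {i. i < Suc k \<and> D i \<noteq> D (Suc i)} = Suc c"
        unfolding set c_def by simp
      moreover define C' where "C' = C(Suc c := D (Suc k))"
      have "C' (Suc c) = D (Suc k)" by (simp add: C'_def)
      moreover have "\<forall>i\<le>Suc c. C' i \<in> \<P>"
        using C(2) Suc.prems(1)[of "Suc k"] by (simp add: C'_def le_Suc_eq)
      moreover have "D k \<subset> D (Suc k)" using Suc.prems(2)[of k] False by auto
      then have "\<forall>i<Suc c. C' i \<subset> C' (Suc i)" using C(1,3) by (simp add: C'_def less_Suc_eq)
      ultimately show ?thesis unfolding Let_def by metis
    qed
  qed
  then obtain C where "\<forall>i\<le>card {i. i < k \<and> D i \<noteq> D (Suc i)}. C i \<in> \<P>"
    "\<forall>i<card {i. i < k \<and> D i \<noteq> D (Suc i)}. C i \<subset> C (Suc i)"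
    unfolding Let_def by blast
  then show ?thesis by (intro chain_length_ge) blast+
qed

text \<open>The length of \<open>M / N\<close>, read through the correspondence theorem.\<close>

definition interval_length ::
    "('a::comm_ring_1 \<Rightarrow> 'b::ab_group_add \<Rightarrow> 'b) \<Rightarrow> 'b set \<Rightarrow> 'b set \<Rightarrow> enat" where
  "interval_length scale N M = chain_length {P. Modules.module.subspace scale P \<and> N \<subseteq> P \<and> P \<subseteq> M}"

lemma interval_length_mono:
  "N' \<subseteq> N \<Longrightarrow> M \<subseteq> M' \<Longrightarrow> interval_length scale N M \<le> interval_length scale N' M'"
  unfolding interval_length_def by (rule chain_length_mono) auto

lemma interval_length_refl [simp]: "interval_length scale N N = 0"
proof -
  have "interval_length scale N N \<le> 0"
    unfolding interval_length_def
  proof (rule chain_length_le)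
    fix k C assume C: "\<And>i. i \<le> k \<Longrightarrow> C i \<in> {P. Modules.module.subspace scale P \<and> N \<subseteq> P \<and> P \<subseteq> N}"
      "\<And>i. i < k \<Longrightarrow> C i \<subset> C (Suc i)"
    show "enat k \<le> 0"
    proof (cases k)
      case (Suc j)
      then show ?thesis using C(1)[of 0] C(1)[of 1] C(2)[of 0] by auto
    qed (simp add: zero_enat_def)
  qed
  then show ?thesis by simp
qed

context Modules.module
begin

lemma interval_length_pos:
  assumes "subspace N" "subspace M" "N \<subset> M"
  shows "1 \<le> interval_length scale N M"
  unfolding interval_length_def one_enat_def
  by (rule chain_length_ge[of 1 "\<lambda>i. if i = 0 then N else M"]) (use assms in auto)

lemma subspace_set_sum:
  assumes "subspace S" "subspace T"
  shows "subspace {x + y | x y. x \<in> S \<and> y \<in> T}"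
proof (rule subspaceI)
  show "0 \<in> {x + y | x y. x \<in> S \<and> y \<in> T}"
    using subspace_0[OF assms(1)] subspace_0[OF assms(2)] by (auto intro!: exI[of _ 0])
next
  fix u v assume "u \<in> {x + y | x y. x \<in> S \<and> y \<in> T}" "v \<in> {x + y | x y. x \<in> S \<and> y \<in> T}"
  then obtain x y x' y' where *: "u = x + y" "v = x' + y'" "x \<in> S" "x' \<in> S" "y \<in> T" "y' \<in> T" by auto
  then have "u + v = (x + x') + (y + y')" by (simp add: ac_simps)
  then show "u + v \<in> {x + y | x y. x \<in> S \<and> y \<in> T}"
    using * subspace_add assms by blast
next
  fix c u assume "u \<in> {x + y | x y. x \<in> S \<and> y \<in> T}"
  then show "scale c u \<in> {x + y | x y. x \<in> S \<and> y \<in> T}"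
    using assms subspace_scale scale_right_distrib by blast
qed

text \<open>One inequality distributes the strict steps of a chain over the two intervals; the other
  concatenates chains that attain both lengths, which are finite if the total is.\<close>

lemma interval_length_add:
  assumes sub: "subspace N" "subspace P" "subspace M" and "N \<subseteq> P" "P \<subseteq> M"
  shows "interval_length scale N M = interval_length scale N P + interval_length scale P M"
proof (rule antisym)
  show "interval_length scale N M \<le> interval_length scale N P + interval_length scale P M"
    unfolding interval_length_def[of _ N M]
  proof (rule chain_length_le)
    fix k C
    assume C: "\<And>i. i \<le> k \<Longrightarrow> C i \<in> {S. subspace S \<and> N \<subseteq> S \<and> S \<subseteq> M}"
      and strict: "\<And>i. i < k \<Longrightarrow> C i \<subset> C (Suc i)"
    \<comment> \<open>by modularity, each strict step of \<open>C\<close> is strict after intersecting with \<open>P\<close> or after adding \<open>P\<close>\<close>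
    define D where "D i = C i \<inter> P" for i
    define E where "E i = {x + y | x y. x \<in> C i \<and> y \<in> P}" for i
    have D: "enat (card {i. i < k \<and> D i \<noteq> D (Suc i)}) \<le> interval_length scale N P"
      unfolding interval_length_def
    proof (rule card_strict_steps_le_chain_length)
      show "D i \<in> {S. subspace S \<and> N \<subseteq> S \<and> S \<subseteq> P}" if "i \<le> k" for i
        using C[OF that] sub \<open>N \<subseteq> P\<close> by (auto simp: D_def intro: subspace_inter)
      show "D i \<subseteq> D (Suc i)" if "i < k" for i
        using strict[OF that] by (auto simp: D_def)
    qed
    have E: "enat (card {i. i < k \<and> E i \<noteq> E (Suc i)}) \<le> interval_length scale P M"
      unfolding interval_length_def
    proof (rule card_strict_steps_le_chain_length)
      show "E i \<in> {S. subspace S \<and> P \<subseteq> S \<and> S \<subseteq> M}" if "i \<le> k" for i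
      proof -
        have Ci: "subspace (C i)" "C i \<subseteq> M" using C[OF that] by auto
        have "P \<subseteq> E i" using subspace_0[OF Ci(1)] by (force simp: E_def)
        moreover have "E i \<subseteq> M" using Ci \<open>P \<subseteq> M\<close> subspace_add[OF sub(3)] by (auto simp: E_def)
        ultimately show ?thesis using subspace_set_sum[OF Ci(1) sub(2)] by (simp add: E_def)
      qed
      show "E i \<subseteq> E (Suc i)" if "i < k" for i
        using strict[OF that] by (auto simp: E_def)
    qed
    have "D i \<noteq> D (Suc i) \<or> E i \<noteq> E (Suc i)" if i: "i < k" for i
    proof (rule ccontr)
      assume "\<not> ?thesis"
      then have eq: "D i = D (Suc i)" "E i = E (Suc i)" by auto
      have "C (Suc i) \<subseteq> C i"
      proof
        fix x assume x: "x \<in> C (Suc i)"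
        then have "x \<in> E (Suc i)" using subspace_0[OF sub(2)] by (force simp: E_def)
        then have "x \<in> E i" using eq by simp
        then obtain c p where cp: "x = c + p" "c \<in> C i" "p \<in> P" unfolding E_def by blast
        have "p = x - c" using cp by simp
        then have "p \<in> C (Suc i)" using x cp strict[OF i] C[of "Suc i"] i subspace_diff[of "C (Suc i)" x c] by auto
        then have "p \<in> C i" using eq(1) cp by (auto simp: D_def)
        then show "x \<in> C i" using cp C[of i] i subspace_add[of "C i" c p] by auto
      qed
      then show False using strict[OF i] by auto
    qed
    then have "{..<k} \<subseteq> {i. i < k \<and> D i \<noteq> D (Suc i)} \<union> {i. i < k \<and> E i \<noteq> E (Suc i)}" by auto
    then have "card {..<k} \<le> card ({i. i < k \<and> D i \<noteq> D (Suc i)} \<union> {i. i < k \<and> E i \<noteq> E (Suc i)})"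
      by (intro card_mono) auto
    also have "\<dots> \<le> card {i. i < k \<and> D i \<noteq> D (Suc i)} + card {i. i < k \<and> E i \<noteq> E (Suc i)}"
      by (rule card_Un_le)
    finally have "enat k \<le> enat (card {i. i < k \<and> D i \<noteq> D (Suc i)}) + enat (card {i. i < k \<and> E i \<noteq> E (Suc i)})"
      by simp
    also have "\<dots> \<le> interval_length scale N P + interval_length scale P M" using D E by (rule add_mono)
    finally show "enat k \<le> interval_length scale N P + interval_length scale P M" .
  qed
next
  show "interval_length scale N P + interval_length scale P M \<le> interval_length scale N M"
  proof (cases "interval_length scale N M")
    case (enat l)
    have "interval_length scale N P \<le> enat l" "interval_length scale P M \<le> enat l"
      unfolding enat[symmetric] using assms by (auto intro: interval_length_mono)
    then obtain k1 k2 where k: "interval_length scale N P = enat k1" "interval_length scale P M = enat k2"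
      by (meson enat_ile)
    obtain C1 where C1: "\<And>i. i \<le> k1 \<Longrightarrow> C1 i \<in> {S. subspace S \<and> N \<subseteq> S \<and> S \<subseteq> P}"
      "\<And>i. i < k1 \<Longrightarrow> C1 i \<subset> C1 (Suc i)"
      by (rule chain_length_attained[OF k(1)[unfolded interval_length_def]]) (use assms in auto)
    obtain C2 where C2: "\<And>i. i \<le> k2 \<Longrightarrow> C2 i \<in> {S. subspace S \<and> P \<subseteq> S \<and> S \<subseteq> M}"
      "\<And>i. i < k2 \<Longrightarrow> C2 i \<subset> C2 (Suc i)"
      by (rule chain_length_attained[OF k(2)[unfolded interval_length_def]]) (use assms in auto)
    \<comment> \<open>\<open>C2 0\<close> is left out, since it may equal \<open>C1 k1\<close>; the
      junction is strict because
      \<open>C1 k1 \<subseteq> P \<subseteq> C2 0 \<subset> C2 1\<close>.\<close>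
    define C where "C i = (if i \<le> k1 then C1 i else C2 (i - k1))" for i
    have "enat (k1 + k2) \<le> interval_length scale N M"
      unfolding interval_length_def
    proof (rule chain_length_ge)
      show "C i \<in> {S. subspace S \<and> N \<subseteq> S \<and> S \<subseteq> M}" if "i \<le> k1 + k2" for i
      proof (cases "i \<le> k1")
        case True
        then show ?thesis using C1(1)[of i] \<open>P \<subseteq> M\<close> by (auto simp: C_def)
      next
        case False
        have "i - k1 \<le> k2" using that by simp
        then show ?thesis using C2(1)[of "i - k1"] False \<open>N \<subseteq> P\<close> by (auto simp: C_def)
      qed
      show "C i \<subset> C (Suc i)" if "i < k1 + k2" for i
      proof -
        consider "i < k1" | "i = k1" | "k1 < i" by linarith
        then show ?thesis
        proof cases
          case 1 then show ?thesis using C1(2) by (simp add: C_def)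
        next
          case 2
          then have "C1 i \<subseteq> C2 0" using C1(1)[of i] C2(1)[of 0] by auto
          then show ?thesis using C2(2)[of 0] 2 that by (auto simp: C_def)
        next
          case 3
          then show ?thesis using C2(2)[of "i - k1"] that by (simp add: C_def Suc_diff_le)
        qed
      qed
    qed
    then show ?thesis using k by simp
  qed simp
qed

text \<open>The second isomorphism theorem \<open>(P + R\<^sub>0 x) / P \<cong> R\<^sub>0 / (P : x)\<close>, as a statement on lengths.\<close>

lemma interval_length_adjoin:
  assumes P: "subspace P"
  shows "interval_length scale P {p + scale a x | p a. p \<in> P} = interval_length (*) {a. scale a x \<in> P} UNIV"
proof (rule antisym)
  interpret base: Modules.module "(*) :: 'a \<Rightarrow> 'a \<Rightarrow> 'a"
    by unfold_locales (simp_all add: algebra_simps)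
  let ?M = "{p + scale a x | p a. p \<in> P}"
  let ?c = "{a. scale a x \<in> P}"
  show "interval_length scale P ?M \<le> interval_length (*) ?c UNIV"
    unfolding interval_length_def
  proof (rule chain_length_transfer)
    fix S assume S: "S \<in> {S. subspace S \<and> P \<subseteq> S \<and> S \<subseteq> ?M}"
    then show "{a. scale a x \<in> S} \<in> {J. base.subspace J \<and> ?c \<subseteq> J \<and> J \<subseteq> UNIV}"
      using subspace_0 subspace_add subspace_scale
      by (auto intro!: base.subspaceI simp: scale_left_distrib scale_scale[symmetric] simp del: scale_scale)
    fix S' assume S': "S' \<in> {S. subspace S \<and> P \<subseteq> S \<and> S \<subseteq> ?M}" and "S \<subset> S'"
    then obtain y where y: "y \<in> S'" "y \<notin> S" by auto
    then obtain p a where pa: "y = p + scale a x" "p \<in> P" using S' by auto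
    have "scale a x = y - p" using pa by simp
    then have "scale a x \<in> S'" using subspace_diff[of S' y p] y pa S' by auto
    moreover have "scale a x \<notin> S" using y pa S subspace_add by auto
    ultimately show "{a. scale a x \<in> S} \<subset> {a. scale a x \<in> S'}" using \<open>S \<subset> S'\<close> by auto
  qed
  show "interval_length (*) ?c UNIV \<le> interval_length scale P ?M"
    unfolding interval_length_def
  proof (rule chain_length_transfer)
    fix J assume J: "J \<in> {J. base.subspace J \<and> ?c \<subseteq> J \<and> J \<subseteq> UNIV}"
    have "subspace {scale a x | a. a \<in> J}"
    proof (rule subspaceI)
      show "0 \<in> {scale a x | a. a \<in> J}" using J base.subspace_0 by force
      show "u + v \<in> {scale a x | a. a \<in> J}"
        if "u \<in> {scale a x | a. a \<in> J}" "v \<in> {scale a x | a. a \<in> J}" for u v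
        using that J base.subspace_add scale_left_distrib[symmetric] by blast
      show "scale c u \<in> {scale a x | a. a \<in> J}" if "u \<in> {scale a x | a. a \<in> J}" for c u
        using that J base.subspace_scale scale_scale by blast
    qed
    from subspace_set_sum[OF P this]
    have "subspace {p + scale a x | p a. p \<in> P \<and> a \<in> J}"
      by (rule back_subst[where P = subspace]) blast
    moreover have "P \<subseteq> {p + scale a x | p a. p \<in> P \<and> a \<in> J}"
    proof
      fix p assume "p \<in> P"
      moreover have "0 \<in> J" using J base.subspace_0 by auto
      ultimately show "p \<in> {p + scale a x | p a. p \<in> P \<and> a \<in> J}"
        by (intro CollectI exI[of _ p] exI[of _ 0]) simp
    qed
    ultimately show "{p + scale a x | p a. p \<in> P \<and> a \<in> J} \<in> {S. subspace S \<and> P \<subseteq> S \<and> S \<subseteq> ?M}"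
      by auto
    fix J' assume J': "J' \<in> {J. base.subspace J \<and> ?c \<subseteq> J \<and> J \<subseteq> UNIV}" and "J \<subset> J'"
    then obtain a where a: "a \<in> J'" "a \<notin> J" by auto
    have "scale a x \<notin> {p + scale a x | p a. p \<in> P \<and> a \<in> J}"
    proof
      assume "scale a x \<in> {p + scale a x | p a. p \<in> P \<and> a \<in> J}"
      then obtain p a' where *: "scale a x = p + scale a' x" "p \<in> P" "a' \<in> J" by auto
      then have "scale (a - a') x \<in> P" by (simp add: scale_left_diff_distrib)
      then have "a - a' \<in> J" using J by auto
      then show False using base.subspace_add[of J "a - a'" a'] * J a by auto
    qed
    moreover have "scale a x \<in> {p + scale a x | p a. p \<in> P \<and> a \<in> J'}"
      using a subspace_0[OF P] by force
    ultimately show "{p + scale a x | p a. p \<in> P \<and> a \<in> J} \<subset> {p + scale a x | p a. p \<in> P \<and> a \<in> J'}"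
      using \<open>J \<subset> J'\<close> by blast
  qed
qed

end

section \<open>From module records to intervals of submodules\<close>

definition module_on :: "('a::comm_ring_1 \<Rightarrow> 'b::ab_group_add \<Rightarrow> 'b) \<Rightarrow> 'b set \<Rightarrow> ('a, 'b) module" where
  "module_on scale G =
     \<lparr>carrier = G, monoid.mult = undefined, one = undefined, ring.zero = 0, add = (+), module.smult = scale\<rparr>"

lemma regular_module_eq: "regular_module ring_of_type_algebra = module_on (*) UNIV"
  by (simp add: regular_module_def module_on_def ring_of_type_algebra_def)

lemma graded_piece_module_eq:
  "graded_piece_module b n = module_on (\<lambda>a p. Poly_Mapping.single 0 a * p) (graded_piece b n)"
  by (simp add: graded_piece_module_def module_on_def)

lemma module_length_eq_chain_length: "module_length R M = chain_length {S. submodule S R M}"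
  by (simp add: module_length_def chain_length_def)

lemma submodule_iff:
  "submodule S R M \<longleftrightarrow> S \<subseteq> carrier M \<and> (\<forall>x\<in>S. \<forall>y\<in>S. x \<oplus>\<^bsub>M\<^esub> y \<in> S) \<and> \<zero>\<^bsub>M\<^esub> \<in> S \<and>
     (\<forall>x\<in>S. m_inv (add_monoid M) x \<in> S) \<and> (\<forall>a\<in>carrier R. \<forall>x\<in>S. a \<odot>\<^bsub>M\<^esub> x \<in> S)"
  by (auto simp: submodule_def submodule_axioms_def subgroup_def)

context Modules.module
begin

lemma submodule_module_on_UNIV:
  "submodule S ring_of_type_algebra (module_on scale UNIV) \<longleftrightarrow> subspace S"
proof -
  have inv: "m_inv (add_monoid (module_on scale UNIV)) x = - x" for x
    unfolding m_inv_def by (rule the_equality) (simp_all add: module_on_def eq_neg_iff_add_eq_0 add.commute)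
  then show ?thesis
    by (auto simp: submodule_iff inv ring_of_type_algebra_def module_on_def
        subspace_0 subspace_add subspace_scale subspace_neg intro!: subspaceI)
qed

lemma module_length_UNIV:
  "module_length ring_of_type_algebra (module_on scale UNIV) = interval_length scale {0} UNIV"
proof -
  have "{S. submodule S ring_of_type_algebra (module_on scale UNIV)} = {P. subspace P \<and> {0} \<subseteq> P \<and> P \<subseteq> UNIV}"
    using subspace_0 by (auto simp: submodule_module_on_UNIV)
  then show ?thesis by (simp add: module_length_eq_chain_length interval_length_def)
qed

text \<open>The correspondence theorem: preimages and images under \<open>coset\<close> both
  preserve strict inclusions of the submodules concerned.\<close>

lemma module_length_quotient:
  assumes N: "subspace N" and G: "subspace G" and "N \<subseteq> G"
  shows "module_length ring_of_type_algebra (quotient_module (module_on scale G) N) = interval_length scale N G"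
proof -
  define Q where "Q = quotient_module (module_on scale G) N"
  define coset where "coset x = {n + x | n. n \<in> N}" for x
  have mem: "y \<in> coset x \<longleftrightarrow> y - x \<in> N" for x y
    by (auto simp: coset_def intro!: exI[of _ "y - x"])
  have eq_iff: "coset x = coset y \<longleftrightarrow> x - y \<in> N" for x y
  proof
    assume "coset x = coset y"
    then have "x \<in> coset y" using mem[of x x] subspace_0[OF N] by simp
    then show "x - y \<in> N" by (simp add: mem)
  next
    assume xy: "x - y \<in> N"
    have "z - x \<in> N \<longleftrightarrow> z - y \<in> N" for z
      using subspace_add[OF N xy, of "z - x"] subspace_diff[OF N _ xy, of "z - y"]
      by (auto simp: algebra_simps)
    then show "coset x = coset y" by (auto simp: mem)
  qed
  have carrier: "carrier Q = coset ` G"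
    by (auto simp: Q_def quotient_module_def module_on_def A_RCOSETS_def RCOSETS_def r_coset_def coset_def)
  have zero: "\<zero>\<^bsub>Q\<^esub> = coset 0"
    by (auto simp: Q_def quotient_module_def coset_def)
  have add: "coset x \<oplus>\<^bsub>Q\<^esub> coset y = coset (x + y)" for x y
  proof -
    have "coset x \<oplus>\<^bsub>Q\<^esub> coset y = {u + v | u v. u \<in> coset x \<and> v \<in> coset y}"
      by (auto simp: Q_def quotient_module_def module_on_def set_add_def set_mult_def)
    also have "\<dots> = coset (x + y)"
    proof (intro subset_antisym subsetI)
      fix z assume "z \<in> {u + v | u v. u \<in> coset x \<and> v \<in> coset y}"
      then obtain u v where "z = u + v" "u - x \<in> N" "v - y \<in> N" by (auto simp: mem)
      then show "z \<in> coset (x + y)" using subspace_add[OF N, of "u - x" "v - y"]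
        by (simp add: mem algebra_simps)
    next
      fix z assume "z \<in> coset (x + y)"
      then have "z - y \<in> coset x" "y \<in> coset y" using subspace_0[OF N] by (simp_all add: mem algebra_simps)
      then show "z \<in> {u + v | u v. u \<in> coset x \<and> v \<in> coset y}"
        by (intro CollectI exI[of _ "z - y"] exI[of _ y]) simp
    qed
    finally show ?thesis .
  qed
  have smult: "a \<odot>\<^bsub>Q\<^esub> coset x = coset (scale a x)" for a x
  proof -
    \<comment> \<open>Scalar multiplication of \<open>quotient_module\<close> is a union over
      representatives; all members of the union coincide.\<close>
    have const: "coset (scale a y) = coset (scale a x)" if "y \<in> coset x" for y
      using that subspace_scale[OF N, of "y - x" a] by (simp add: mem eq_iff scale_right_diff_distrib)
    have "x \<in> coset x" using subspace_0[OF N] by (simp add: mem)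
    moreover have "a \<odot>\<^bsub>Q\<^esub> coset x = (\<Union>y\<in>coset x. coset (scale a y))"
      by (auto simp: Q_def quotient_module_def module_on_def a_r_coset_def r_coset_def coset_def)
    moreover have "(\<Union>y\<in>coset x. coset (scale a y)) = (\<Union>y\<in>coset x. coset (scale a x))"
      by (rule SUP_cong[OF refl const])
    ultimately show ?thesis by (metis UN_constant empty_iff)
  qed
  have inv: "m_inv (add_monoid Q) (coset x) = coset (- x)" if "x \<in> G" for x
    unfolding m_inv_def
  proof (rule the_equality)
    show "coset (- x) \<in> carrier (add_monoid Q) \<and>
      coset x \<otimes>\<^bsub>add_monoid Q\<^esub> coset (- x) = \<one>\<^bsub>add_monoid Q\<^esub> \<and>
      coset (- x) \<otimes>\<^bsub>add_monoid Q\<^esub> coset x = \<one>\<^bsub>add_monoid Q\<^esub>"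
      using that subspace_neg[OF G] by (simp add: carrier add zero)
  next
    fix y assume *: "y \<in> carrier (add_monoid Q) \<and>
      coset x \<otimes>\<^bsub>add_monoid Q\<^esub> y = \<one>\<^bsub>add_monoid Q\<^esub> \<and>
      y \<otimes>\<^bsub>add_monoid Q\<^esub> coset x = \<one>\<^bsub>add_monoid Q\<^esub>"
    then obtain z where "y = coset z" by (auto simp: carrier)
    then show "y = coset (- x)" using * by (simp add: add zero eq_iff add.commute)
  qed
  have "chain_length {S. submodule S ring_of_type_algebra Q} \<le> interval_length scale N G"
    unfolding interval_length_def
  proof (rule chain_length_transfer)
    fix S assume "S \<in> {S. submodule S ring_of_type_algebra Q}"
    then have S: "S \<subseteq> carrier Q" "\<And>x y. x \<in> S \<Longrightarrow> y \<in> S \<Longrightarrow> x \<oplus>\<^bsub>Q\<^esub> y \<in> S" "coset 0 \<in> S"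
      "\<And>a x. x \<in> S \<Longrightarrow> a \<odot>\<^bsub>Q\<^esub> x \<in> S"
      by (auto simp: submodule_iff zero ring_of_type_algebra_def)
    have "subspace {x \<in> G. coset x \<in> S}"
    proof (rule subspaceI)
      show "x + y \<in> {x \<in> G. coset x \<in> S}"
        if "x \<in> {x \<in> G. coset x \<in> S}" "y \<in> {x \<in> G. coset x \<in> S}" for x y
        using that S(2)[of "coset x" "coset y"] subspace_add[OF G] by (simp add: add)
      show "scale a x \<in> {x \<in> G. coset x \<in> S}" if "x \<in> {x \<in> G. coset x \<in> S}" for a x
        using that S(4)[of "coset x" a] subspace_scale[OF G] by (simp add: smult)
    qed (use S(3) subspace_0[OF G] in simp)
    moreover have "coset n = coset 0" if "n \<in> N" for n using that by (simp add: eq_iff)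
    ultimately show "{x \<in> G. coset x \<in> S} \<in> {P. subspace P \<and> N \<subseteq> P \<and> P \<subseteq> G}"
      using S(3) \<open>N \<subseteq> G\<close> by auto
    fix S' assume "S' \<in> {S. submodule S ring_of_type_algebra Q}" "S \<subset> S'"
    moreover from this have "S' \<subseteq> coset ` G" by (auto simp: submodule_iff carrier)
    ultimately show "{x \<in> G. coset x \<in> S} \<subset> {x \<in> G. coset x \<in> S'}" by blast
  qed
  moreover have "interval_length scale N G \<le> chain_length {S. submodule S ring_of_type_algebra Q}"
    unfolding interval_length_def
  proof (rule chain_length_transfer)
    fix P assume "P \<in> {P. subspace P \<and> N \<subseteq> P \<and> P \<subseteq> G}"
    then have P: "subspace P" "N \<subseteq> P" "P \<subseteq> G" by auto
    show "coset ` P \<in> {S. submodule S ring_of_type_algebra Q}"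
      unfolding mem_Collect_eq submodule_iff
    proof (intro conjI ballI)
      show "m_inv (add_monoid Q) y \<in> coset ` P" if "y \<in> coset ` P" for y
        using that P inv subspace_neg[OF P(1)] by blast
    qed (use P subspace_0[OF P(1)] subspace_add[OF P(1)] subspace_scale[OF P(1)] in
        \<open>auto simp: carrier zero add smult\<close>)
    fix P' assume P': "P' \<in> {P. subspace P \<and> N \<subseteq> P \<and> P \<subseteq> G}" "P \<subset> P'"
    then obtain x where x: "x \<in> P'" "x \<notin> P" by auto
    have "coset x \<notin> coset ` P"
    proof
      assume "coset x \<in> coset ` P"
      then obtain y where y: "y \<in> P" "x - y \<in> N" by (auto simp: eq_iff)
      then have "(x - y) + y \<in> P" using P subspace_add[OF P(1)] by blast
      then show False using x by simp
    qed
    then show "coset ` P \<subset> coset ` P'" using x P'(2) by blast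
  qed
  ultimately show ?thesis by (simp add: module_length_eq_chain_length Q_def)
qed

end

section \<open>Hilbert functions and leading coefficients\<close>

interpretation scalar: Modules.module "(*) :: 'a::comm_ring_1 \<Rightarrow> 'a \<Rightarrow> 'a"
  by unfold_locales (simp_all add: algebra_simps)

abbreviation poly_scale :: "'a::comm_ring_1 \<Rightarrow> 'a mpoly \<Rightarrow> 'a mpoly" where
  "poly_scale a p \<equiv> Poly_Mapping.single 0 a * p"

interpretation poly: Modules.module "poly_scale :: 'a::comm_ring_1 \<Rightarrow> 'a mpoly \<Rightarrow> 'a mpoly"
  by unfold_locales (simp_all add: distrib_left distrib_right single_add mult_single flip: mult.assoc)

lemma lookup_poly_scale: "Poly_Mapping.lookup (poly_scale a p) t = a * Poly_Mapping.lookup p t"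
  by (subst mult_map_scale_conv_mult[symmetric]) (simp add: Poly_Mapping.map.rep_eq when_def)

lemma keys_poly_scale: "Poly_Mapping.keys (poly_scale a p) \<subseteq> Poly_Mapping.keys p"
proof
  fix t assume "t \<in> Poly_Mapping.keys (poly_scale a p)"
  then have "a * Poly_Mapping.lookup p t \<noteq> 0" by (simp only: in_keys_iff lookup_poly_scale not_False_eq_True)
  then show "t \<in> Poly_Mapping.keys p" unfolding in_keys_iff by (metis mult_zero_right)
qed

lemma keys_uminus [simp]: "Poly_Mapping.keys (- p :: 'x \<Rightarrow>\<^sub>0 'a::ab_group_add) = Poly_Mapping.keys p"
  by (auto simp: in_keys_iff)

lemma poly_mapping_eq_sum_single:
  "p = (\<Sum>t\<in>Poly_Mapping.keys p. Poly_Mapping.single t (Poly_Mapping.lookup p t))"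
  by (rule poly_mapping_eqI)
    (auto simp: lookup_sum lookup_single when_def in_keys_iff sum.delta split: if_splits)

lemma keys_single_mult:
  "Poly_Mapping.keys (Poly_Mapping.single u a * p) \<subseteq> (\<lambda>t. u + t) ` Poly_Mapping.keys p"
proof -
  have "Poly_Mapping.keys (Poly_Mapping.single u a * p) \<subseteq>
      {s + t | s t. s \<in> Poly_Mapping.keys (Poly_Mapping.single u a) \<and> t \<in> Poly_Mapping.keys p}"
    by (rule keys_mult)
  then show ?thesis by (auto split: if_splits)
qed

lemma carrier_mpoly_ring: "carrier (mpoly_ring b) = {p. \<forall>t\<in>Poly_Mapping.keys p. Poly_Mapping.keys t \<subseteq> {..<b}}"
  and mult_mpoly_ring: "p \<otimes>\<^bsub>mpoly_ring b\<^esub> p' = p * p'"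
  and one_mpoly_ring: "\<one>\<^bsub>mpoly_ring b\<^esub> = 1"
  and add_mpoly_ring: "p \<oplus>\<^bsub>mpoly_ring b\<^esub> p' = p + p'"
  and zero_mpoly_ring: "\<zero>\<^bsub>mpoly_ring b\<^esub> = 0"
  by (simp_all add: mpoly_ring_def ring_of_type_algebra_def)

lemmas mpoly_ring_simps = mult_mpoly_ring one_mpoly_ring add_mpoly_ring zero_mpoly_ring

lemma m_inv_mpoly_ring:
  assumes "p \<in> carrier (mpoly_ring b)"
  shows "m_inv (add_monoid (mpoly_ring b)) p = - p"
  unfolding m_inv_def using assms
  by (intro the_equality) (auto simp: mpoly_ring_simps carrier_mpoly_ring eq_neg_iff_add_eq_0 add.commute)

lemma graded_piece_eq: "graded_piece b n = {p. Poly_Mapping.keys p \<subseteq> monomials b n}"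
  by (auto simp: graded_piece_def carrier_mpoly_ring monomials_def)

definition poly_on :: "(nat \<Rightarrow>\<^sub>0 nat) set \<Rightarrow> 'a::comm_ring_1 mpoly set" where
  "poly_on A = {p. Poly_Mapping.keys p \<subseteq> A}"

lemma subspace_poly_on: "poly.subspace (poly_on A)"
proof (rule poly.subspaceI)
  show "p + p' \<in> poly_on A" if "p \<in> poly_on A" "p' \<in> poly_on A" for p p'
    using that Poly_Mapping.keys_add[of p p'] unfolding poly_on_def by blast
  show "poly_scale a p \<in> poly_on A" if "p \<in> poly_on A" for a p
    using that keys_poly_scale[of a p] unfolding poly_on_def by blast
qed (simp add: poly_on_def)

lemma graded_piece_eq_poly_on: "graded_piece b n = poly_on (monomials b n)"
  by (simp add: graded_piece_eq poly_on_def)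

lemma subspace_ideal:
  assumes "ideal I (mpoly_ring b)"
  shows "poly.subspace I"
proof -
  interpret ideal I "mpoly_ring b" by fact
  show ?thesis
  proof (rule poly.subspaceI)
    show "0 \<in> I" using additive_subgroup.zero_closed[OF ideal.axioms(1)[OF assms]] by (simp add: mpoly_ring_simps)
    show "p + p' \<in> I" if "p \<in> I" "p' \<in> I" for p p'
      using additive_subgroup.a_closed[OF ideal.axioms(1)[OF assms] that] by (simp add: mpoly_ring_simps)
    show "poly_scale a p \<in> I" if "p \<in> I" for a p
    proof -
      have "Poly_Mapping.single 0 a \<in> carrier (mpoly_ring b)" by (simp add: carrier_mpoly_ring)
      then show ?thesis using I_l_closed[OF that] by (simp add: mpoly_ring_simps)
    qed
  qed
qed

section \<open>Leading coefficients and the Hilbert function\<close>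

text \<open>Membership means that \<open>I\<close> contains a polynomial with coefficient
  \<open>a\<close> at \<open>t\<close> and all other monomials in \<open>A\<close> below
  \<open>t\<close>. In this form it is the colon ideal that \<open>interval_length_adjoin\<close>
  produces. The order is the linear order on \<open>poly_mapping\<close>, not the one behind
  \<open>last_monomials\<close>.\<close>

definition leading_ideal ::
    "'a::comm_ring_1 mpoly set \<Rightarrow> (nat \<Rightarrow>\<^sub>0 nat) set \<Rightarrow> (nat \<Rightarrow>\<^sub>0 nat) \<Rightarrow> 'a set" where
  "leading_ideal I A t =
     {a. Poly_Mapping.single t a \<in> {f + g | f g. f \<in> I \<and> g \<in> poly_on {u \<in> A. u < t}}}"

lemma poly_on_insert:
  "poly_on (insert t A) = {g + poly_scale a (Poly_Mapping.single t 1) | g a. g \<in> poly_on A}"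
proof (intro subset_antisym subsetI)
  fix p :: "'a mpoly" assume p: "p \<in> poly_on (insert t A)"
  define g where "g = p - Poly_Mapping.single t (Poly_Mapping.lookup p t)"
  have "g \<in> poly_on A" using p
    by (auto simp: poly_on_def g_def in_keys_iff lookup_minus lookup_single when_def subset_iff split: if_splits)
  moreover have "p = g + poly_scale (Poly_Mapping.lookup p t) (Poly_Mapping.single t 1)"
    by (simp add: g_def mult_single)
  ultimately show "p \<in> {g + poly_scale a (Poly_Mapping.single t 1) | g a. g \<in> poly_on A}" by blast
next
  fix p :: "'a mpoly" assume "p \<in> {g + poly_scale a (Poly_Mapping.single t 1) | g a. g \<in> poly_on A}"
  then show "p \<in> poly_on (insert t A)"
    by (auto simp: poly_on_def in_keys_iff lookup_add mult_single lookup_single when_def subset_iff split: if_splits)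
qed

text \<open>Monomials are inserted in increasing order: all of \<open>A\<close> lies below the new
  \<open>t\<close>, whose adjunction contributes its colon ideal, and the earlier ideals see only
  smaller monomials and do not change.\<close>

lemma interval_length_eq_sum_leading_ideal:
  assumes I: "poly.subspace I" and "finite A"
  shows "interval_length poly_scale I {f + g | f g. f \<in> I \<and> g \<in> poly_on A} =
           (\<Sum>t\<in>A. interval_length (*) (leading_ideal I A t) UNIV)"
  using \<open>finite A\<close>
proof (induction A rule: finite_linorder_max_induct)
  case empty
  have "{f + g | f g. f \<in> I \<and> g \<in> poly_on {}} = I" by (auto simp: poly_on_def)
  then show ?case by simp
next
  case (insert t A)
  let ?IA = "{f + g | f g. f \<in> I \<and> g \<in> poly_on A}"
  let ?x = "Poly_Mapping.single t 1 :: 'a mpoly"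
  have IA: "poly.subspace ?IA" by (rule poly.subspace_set_sum[OF I subspace_poly_on])
  have adjoin: "{f + g | f g. f \<in> I \<and> g \<in> poly_on (insert t A)} = {p + poly_scale a ?x | p a. p \<in> ?IA}"
  proof (intro subset_antisym subsetI)
    fix p assume "p \<in> {f + g | f g. f \<in> I \<and> g \<in> poly_on (insert t A)}"
    then obtain f g a where "p = f + (g + poly_scale a ?x)" "f \<in> I" "g \<in> poly_on A"
      unfolding poly_on_insert by blast
    then have "p = (f + g) + poly_scale a ?x" "f + g \<in> ?IA" by (simp_all add: add.assoc) blast
    then show "p \<in> {p + poly_scale a ?x | p a. p \<in> ?IA}" by blast
  next
    fix p assume "p \<in> {p + poly_scale a ?x | p a. p \<in> ?IA}"
    then obtain f g a where "p = f + (g + poly_scale a ?x)" "f \<in> I" "g \<in> poly_on A"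
      by (auto simp: add.assoc)
    then show "p \<in> {f + g | f g. f \<in> I \<and> g \<in> poly_on (insert t A)}"
      unfolding poly_on_insert by blast
  qed
  have sub: "poly.subspace {f + g | f g. f \<in> I \<and> g \<in> poly_on (insert t A)}"
    by (rule poly.subspace_set_sum[OF I subspace_poly_on])
  have le1: "I \<subseteq> ?IA"
  proof
    fix f assume "f \<in> I"
    then show "f \<in> ?IA"
      using poly.subspace_0[OF subspace_poly_on[of A]] by (intro CollectI exI[of _ f] exI[of _ 0]) simp
  qed
  have le2: "?IA \<subseteq> {f + g | f g. f \<in> I \<and> g \<in> poly_on (insert t A)}"
    by (auto simp: poly_on_def)
  have "interval_length poly_scale I {f + g | f g. f \<in> I \<and> g \<in> poly_on (insert t A)} =
      interval_length poly_scale I ?IA + interval_length (*) {a. poly_scale a ?x \<in> ?IA} UNIV"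
    using poly.interval_length_add[OF I IA sub le1 le2] poly.interval_length_adjoin[OF IA, of ?x]
    by (simp only: adjoin)
  moreover have "{u \<in> insert t A. u < t} = A" using insert.hyps by auto
  then have "{a. poly_scale a ?x \<in> ?IA} = leading_ideal I (insert t A) t"
    by (simp add: leading_ideal_def mult_single)
  moreover have "leading_ideal I (insert t A) u = leading_ideal I A u" if "u \<in> A" for u
  proof -
    have "\<not> t < u" using insert.hyps that by (meson less_asym)
    then have "{v \<in> insert t A. v < u} = {v \<in> A. v < u}" by blast
    then show ?thesis by (simp add: leading_ideal_def)
  qed
  moreover have "t \<notin> A" using insert.hyps by auto
  ultimately show ?case using insert.IH insert.hyps by (simp add: add.commute)
qed

lemma hilbert_function_eq_sum:
  assumes "ideal I (mpoly_ring b)"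
  shows "hilbert_function b I n =
    (\<Sum>t\<in>monomials b n. interval_length (*) (leading_ideal (I \<inter> graded_piece b n) (monomials b n) t) UNIV)"
proof -
  let ?In = "I \<inter> graded_piece b n"
  have In: "poly.subspace ?In"
    using subspace_ideal[OF assms] subspace_poly_on unfolding graded_piece_eq_poly_on
    by (rule poly.subspace_inter)
  have eq: "graded_piece b n = {f + g | f g. f \<in> ?In \<and> g \<in> poly_on (monomials b n)}"
  proof (intro subset_antisym subsetI)
    fix p :: "'a mpoly" assume "p \<in> graded_piece b n"
    then have "p = 0 + p" "0 \<in> ?In" "p \<in> poly_on (monomials b n)"
      using poly.subspace_0[OF In] by (simp_all add: graded_piece_eq_poly_on)
    then show "p \<in> {f + g | f g. f \<in> ?In \<and> g \<in> poly_on (monomials b n)}" by blast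
  next
    fix p :: "'a mpoly" assume "p \<in> {f + g | f g. f \<in> ?In \<and> g \<in> poly_on (monomials b n)}"
    then show "p \<in> graded_piece b n"
      using poly.subspace_add[OF subspace_poly_on] by (auto simp: graded_piece_eq_poly_on)
  qed
  have "hilbert_function b I n = interval_length poly_scale ?In (graded_piece b n)"
    unfolding hilbert_function_def graded_piece_module_eq
    by (rule poly.module_length_quotient[OF In]) (simp_all add: graded_piece_eq_poly_on subspace_poly_on)
  also have "\<dots> = interval_length poly_scale ?In {f + g | f g. f \<in> ?In \<and> g \<in> poly_on (monomials b n)}"
    by (rule arg_cong[OF eq])
  also have "\<dots> =
    (\<Sum>t\<in>monomials b n. interval_length (*) (leading_ideal ?In (monomials b n) t) UNIV)"
    by (rule interval_length_eq_sum_leading_ideal[OF In finite_monomials])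
  finally show ?thesis .
qed

text \<open>Multiplication by a variable keeps leading coefficients, the order being compatible with
  addition of exponents.\<close>

lemma leading_ideal_mono:
  assumes I: "ideal I (mpoly_ring b)" and "i < b" and t: "t \<in> monomials b n"
  shows "leading_ideal (I \<inter> graded_piece b n) (monomials b n) t \<subseteq>
         leading_ideal (I \<inter> graded_piece b (Suc n)) (monomials b (Suc n)) (t + var i)"
proof
  fix a assume "a \<in> leading_ideal (I \<inter> graded_piece b n) (monomials b n) t"
  then obtain f g where fg: "Poly_Mapping.single t a = f + g" "f \<in> I" "f \<in> graded_piece b n"
    "g \<in> poly_on {u \<in> monomials b n. u < t}" unfolding leading_ideal_def by blast
  let ?x = "Poly_Mapping.single (var i) 1 :: 'a mpoly"
  interpret ideal I "mpoly_ring b" by fact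
  have "?x \<in> carrier (mpoly_ring b)" using \<open>i < b\<close> by (simp add: carrier_mpoly_ring)
  then have "?x * f \<in> I" using I_l_closed[OF fg(2)] by (simp add: mpoly_ring_simps)
  moreover have "?x * f \<in> graded_piece b (Suc n)"
    using keys_single_mult[of "var i" 1 f] fg(3) \<open>i < b\<close>
    by (fastforce simp: graded_piece_eq add_var_in_monomials_iff add.commute[of "var i"])
  moreover have "?x * g \<in> poly_on {u \<in> monomials b (Suc n). u < t + var i}"
    using keys_single_mult[of "var i" 1 g] fg(4) \<open>i < b\<close>
    by (fastforce simp: poly_on_def add_var_in_monomials_iff add.commute[of "var i"])
  moreover have "Poly_Mapping.single (t + var i) a = ?x * f + ?x * g"
    using arg_cong[OF fg(1), of "\<lambda>p. ?x * p"] by (simp add: mult_single distrib_left add.commute)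
  ultimately show "a \<in> leading_ideal (I \<inter> graded_piece b (Suc n)) (monomials b (Suc n)) (t + var i)"
    unfolding leading_ideal_def by blast
qed

lemma card_monomials_eq_choose:
  "0 < b \<Longrightarrow> card (monomials b n) = (n + b - 1) choose (b - 1)"
  using binomial_symmetric[of n "b + n - 1"] by (simp add: card_monomials add.commute)

lemma interval_length_leading_ideal_le:
  fixes I :: "'a::comm_ring_1 mpoly set"
  shows "0 \<in> I \<Longrightarrow>
     interval_length (*) (leading_ideal I A t) UNIV \<le> interval_length (*) {0::'a} UNIV"
proof (rule interval_length_mono)
  assume "0 \<in> I"
  moreover have "0 \<in> poly_on {u \<in> A. u < t}" by (simp add: poly_on_def)
  moreover have "Poly_Mapping.single t 0 = 0 + 0" by simp
  ultimately show "{0} \<subseteq> leading_ideal I A t" unfolding leading_ideal_def by blast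
qed simp

lemma leading_ideal_0:
  fixes I :: "'a::comm_ring_1 mpoly set"
  assumes "I \<subseteq> positive_part b" "0 \<in> I"
  shows "leading_ideal (I \<inter> graded_piece b 0) (monomials b 0) 0 = {0}"
proof -
  have "p = 0" if "p \<in> I \<inter> graded_piece b 0" for p
  proof -
    have "\<forall>t\<in>Poly_Mapping.keys p. 1 \<le> monom_degree t \<and> monom_degree t = 0"
      using that assms(1) by (auto simp: positive_part_def graded_piece_def)
    then have "Poly_Mapping.keys p = {}" by (metis all_not_in_conv not_one_le_zero)
    then show ?thesis by simp
  qed
  moreover have "0 \<in> graded_piece b 0" by (simp add: graded_piece_eq)
  ultimately have I0: "I \<inter> graded_piece b 0 = {0}" using assms(2) by blast
  have empty: "{u \<in> monomials b 0. u < 0} = {}" by (auto simp: monomials_0)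
  have "poly_on {u \<in> monomials b 0. u < 0} = {0::'a mpoly}" unfolding empty by (auto simp: poly_on_def)
  moreover have "Poly_Mapping.single 0 a = (0 :: 'a mpoly) \<longleftrightarrow> a = 0" for a
    by (metis lookup_single_eq lookup_zero single_zero)
  ultimately show ?thesis unfolding leading_ideal_def I0 by simp
qed

text \<open>Each leading ideal contains 0, so its colength is at most the length of the coefficient
  ring; finiteness allows \<open>the_enat\<close> to turn colengths into natural weights.\<close>

lemma hilbert_function_eq_sum_weights:
  fixes I :: "'a::comm_ring_1 mpoly set"
  assumes I: "ideal I (mpoly_ring b)" and pos: "I \<subseteq> positive_part b"
    and fin: "interval_length (*) {0::'a} UNIV \<noteq> \<infinity>"
  obtains h where "\<And>n. hilbert_function b I n = enat (sum h (monomials b n))"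
    "\<And>n t i. t \<in> monomials b n \<Longrightarrow> i < b \<Longrightarrow> h (t + var i) \<le> h t"
    "enat (h 0) = interval_length (*) {0::'a} UNIV"
proof
  define c where
    "c t = leading_ideal (I \<inter> graded_piece b (monom_degree t)) (monomials b (monom_degree t)) t" for t
  define h where "h t = the_enat (interval_length (*) (c t) UNIV)" for t
  have I0: "0 \<in> I" using poly.subspace_0[OF subspace_ideal[OF I]] .
  have h: "enat (h t) = interval_length (*) (c t) UNIV" for t
  proof -
    have "0 \<in> I \<inter> graded_piece b (monom_degree t)" using I0 by (simp add: graded_piece_eq)
    then have "interval_length (*) (c t) UNIV \<noteq> \<infinity>"
      using interval_length_leading_ideal_le fin unfolding c_def by (metis enat_ord_simps(5))
    then obtain k where "interval_length (*) (c t) UNIV = enat k" by blast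
    then show ?thesis by (simp add: h_def)
  qed
  show "hilbert_function b I n = enat (sum h (monomials b n))" for n
  proof -
    have "hilbert_function b I n = (\<Sum>t\<in>monomials b n. enat (h t))"
      unfolding hilbert_function_eq_sum[OF I] h by (rule sum.cong) (simp_all add: c_def monomials_def)
    then show ?thesis by (simp flip: of_nat_eq_enat)
  qed
  show "h (t + var i) \<le> h t" if "t \<in> monomials b n" "i < b" for n t i
  proof -
    have "monom_degree t = n" using that by (simp add: monomials_def)
    then have "c t \<subseteq> c (t + var i)" using leading_ideal_mono[OF I that(2,1)] by (simp add: c_def)
    then have "enat (h (t + var i)) \<le> enat (h t)" unfolding h by (intro interval_length_mono) simp_all
    then show ?thesis by simp
  qed
  show "enat (h 0) = interval_length (*) {0::'a} UNIV"
    unfolding h c_def using leading_ideal_0[OF pos I0] by simp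
qed

section \<open>Ideals prescribed coefficient by coefficient\<close>

lemma m_inv_ring_of_type_algebra: "m_inv (add_monoid ring_of_type_algebra) x = - (x :: 'a::comm_ring_1)"
  unfolding m_inv_def
  by (rule the_equality) (simp_all add: ring_of_type_algebra_def eq_neg_iff_add_eq_0 add.commute)

lemma ring_mpoly_ring: "ring (mpoly_ring b :: 'a::comm_ring_1 mpoly ring)"
proof -
  let ?R = "ring_of_type_algebra :: 'a mpoly ring"
  let ?H = "{p :: 'a mpoly. \<forall>t\<in>Poly_Mapping.keys p. Poly_Mapping.keys t \<subseteq> {..<b}}"
  interpret ring ?R by (rule ring_from_type_algebra)
  have "subring ?H ?R"
  proof (rule subringI)
    show "\<ominus>\<^bsub>?R\<^esub> p \<in> ?H" if "p \<in> ?H" for p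
      using that by (simp only: a_inv_def m_inv_ring_of_type_algebra mem_Collect_eq keys_uminus)
    show "p \<otimes>\<^bsub>?R\<^esub> p' \<in> ?H" if "p \<in> ?H" "p' \<in> ?H" for p p'
      using that keys_mult[of p p'] by (fastforce simp: ring_of_type_algebra_def keys_plus_nat)
    show "p \<oplus>\<^bsub>?R\<^esub> p' \<in> ?H" if "p \<in> ?H" "p' \<in> ?H" for p p'
      using that Poly_Mapping.keys_add[of p p'] by (auto simp: ring_of_type_algebra_def)
  qed (auto simp: ring_of_type_algebra_def)
  then show ?thesis unfolding mpoly_ring_def by (rule subring_is_ring)
qed

text \<open>A monomial ideal with coefficients: the direct sum of the sets \<open>c t\<close> times
  the monomial \<open>t\<close>.\<close>

definition coefficientwise :: "nat \<Rightarrow> ((nat \<Rightarrow>\<^sub>0 nat) \<Rightarrow> 'a set) \<Rightarrow> 'a::comm_ring_1 mpoly set" where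
  "coefficientwise b c = {p \<in> carrier (mpoly_ring b). \<forall>t. Poly_Mapping.lookup p t \<in> c t}"

context
  fixes b :: nat and c :: "(nat \<Rightarrow>\<^sub>0 nat) \<Rightarrow> 'a::comm_ring_1 set"
  assumes sub: "\<And>t. scalar.subspace (c t)"
    and mono: "\<And>t i. Poly_Mapping.keys t \<subseteq> {..<b} \<Longrightarrow> i < b \<Longrightarrow> c t \<subseteq> c (t + var i)"
begin

lemma coefficient_ideal_mono:
  assumes "Poly_Mapping.keys t \<subseteq> {..<b}" "u \<in> monomials b n"
  shows "c t \<subseteq> c (u + t)"
  using assms(2)
proof (induction n arbitrary: u)
  case 0
  then show ?case by (simp add: monomials_0)
next
  case (Suc n)
  from Suc.prems obtain i v where v: "i < b" "u = v + var i" "v \<in> monomials b n" by (rule monomials_SucE)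
  then have "Poly_Mapping.keys (v + t) \<subseteq> {..<b}" using assms(1) by (auto simp: keys_plus_nat monomials_def)
  then have "c (v + t) \<subseteq> c ((v + t) + var i)" using v by (intro mono)
  moreover have "(v + t) + var i = u + t" using v by (simp add: ac_simps)
  ultimately show ?case using Suc.IH[OF v(3)] by simp
qed

lemma subspace_coefficientwise: "poly.subspace (coefficientwise b c)"
proof (rule poly.subspaceI)
  show "p + p' \<in> coefficientwise b c" if "p \<in> coefficientwise b c" "p' \<in> coefficientwise b c" for p p'
  proof -
    have "\<forall>t\<in>Poly_Mapping.keys (p + p'). Poly_Mapping.keys t \<subseteq> {..<b}"
      using that Poly_Mapping.keys_add[of p p'] unfolding coefficientwise_def carrier_mpoly_ring by blast
    then show ?thesis
      using that scalar.subspace_add[OF sub] by (simp add: coefficientwise_def carrier_mpoly_ring lookup_add)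
  qed
  show "poly_scale a p \<in> coefficientwise b c" if "p \<in> coefficientwise b c" for a p
  proof -
    have "\<forall>t\<in>Poly_Mapping.keys (poly_scale a p). Poly_Mapping.keys t \<subseteq> {..<b}"
      using that keys_poly_scale[of a p] unfolding coefficientwise_def carrier_mpoly_ring by blast
    then show ?thesis
      using that scalar.subspace_scale[OF sub]
      by (simp add: coefficientwise_def carrier_mpoly_ring lookup_poly_scale)
  qed
qed (simp add: coefficientwise_def carrier_mpoly_ring scalar.subspace_0[OF sub])

text \<open>Expanding both factors into terms reduces the claim to one pair of monomials, where
  \<open>c\<close> grows along the factor \<open>u\<close>.\<close>

lemma mult_in_coefficientwise:
  assumes p: "p \<in> carrier (mpoly_ring b)" and x: "x \<in> coefficientwise b c"
  shows "p * x \<in> coefficientwise b c"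
proof -
  let ?p = "Poly_Mapping.lookup p" and ?x = "Poly_Mapping.lookup x"
  have "p * x = (\<Sum>u\<in>Poly_Mapping.keys p. Poly_Mapping.single u (?p u)) *
                (\<Sum>t\<in>Poly_Mapping.keys x. Poly_Mapping.single t (?x t))"
    using poly_mapping_eq_sum_single[of p] poly_mapping_eq_sum_single[of x] by simp
  also have "\<dots> = (\<Sum>u\<in>Poly_Mapping.keys p. \<Sum>t\<in>Poly_Mapping.keys x.
      Poly_Mapping.single (u + t) (?p u * ?x t))"
    by (simp add: sum_product mult_single)
  also have "\<dots> \<in> coefficientwise b c"
  proof (intro poly.subspace_sum[OF subspace_coefficientwise])
    fix u t assume u: "u \<in> Poly_Mapping.keys p" and t: "t \<in> Poly_Mapping.keys x"
    have ku: "Poly_Mapping.keys u \<subseteq> {..<b}" using p u by (auto simp: carrier_mpoly_ring)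
    have kt: "Poly_Mapping.keys t \<subseteq> {..<b}" using x t by (auto simp: carrier_mpoly_ring coefficientwise_def)
    have "u \<in> monomials b (monom_degree u)" using ku by (simp add: monomials_def)
    then have "?x t \<in> c (u + t)"
      using coefficient_ideal_mono[OF kt] x by (auto simp: coefficientwise_def)
    then have "?p u * ?x t \<in> c (u + t)" using scalar.subspace_scale[OF sub] by blast
    then show "Poly_Mapping.single (u + t) (?p u * ?x t) \<in> coefficientwise b c"
      using ku kt scalar.subspace_0[OF sub]
      by (auto simp: coefficientwise_def carrier_mpoly_ring lookup_single when_def keys_plus_nat)
  qed
  finally show ?thesis .
qed

lemma ideal_coefficientwise: "ideal (coefficientwise b c) (mpoly_ring b)"
proof (rule idealI[OF ring_mpoly_ring])
  have "m_inv (add_monoid (mpoly_ring b)) p \<in> coefficientwise b c" if "p \<in> coefficientwise b c" for p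
  proof -
    have p: "p \<in> carrier (mpoly_ring b)" using that by (simp add: coefficientwise_def)
    show ?thesis
      unfolding m_inv_mpoly_ring[OF p] by (rule poly.subspace_neg[OF subspace_coefficientwise that])
  qed
  then show "subgroup (coefficientwise b c) (add_monoid (mpoly_ring b))"
    using poly.subspace_add[OF subspace_coefficientwise] poly.subspace_0[OF subspace_coefficientwise]
    by (auto simp: subgroup_def mpoly_ring_simps) (auto simp: coefficientwise_def)
  show "x \<otimes>\<^bsub>mpoly_ring b\<^esub> p \<in> coefficientwise b c" "p \<otimes>\<^bsub>mpoly_ring b\<^esub> x \<in> coefficientwise b c"
    if "p \<in> coefficientwise b c" "x \<in> carrier (mpoly_ring b)" for p x
    using mult_in_coefficientwise[OF that(2,1)] by (simp_all add: mpoly_ring_simps mult.commute)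
qed

lemma homogeneous_ideal_coefficientwise: "homogeneous_ideal b (coefficientwise b c)"
proof -
  have "homogeneous_component n p \<in> coefficientwise b c" if p: "p \<in> coefficientwise b c" for p n
    unfolding homogeneous_component_def
  proof (rule poly.subspace_sum[OF subspace_coefficientwise])
    fix t assume "t \<in> {t \<in> Poly_Mapping.keys p. monom_degree t = n}"
    then show "Poly_Mapping.single t (Poly_Mapping.lookup p t) \<in> coefficientwise b c"
      using p scalar.subspace_0[OF sub]
      by (auto simp: coefficientwise_def carrier_mpoly_ring lookup_single when_def)
  qed
  then show ?thesis by (simp add: homogeneous_ideal_def ideal_coefficientwise)
qed

lemma leading_ideal_coefficientwise:
  assumes t: "t \<in> monomials b n"
  shows "leading_ideal (coefficientwise b c \<inter> graded_piece b n) (monomials b n) t = c t"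
proof (intro subset_antisym subsetI)
  fix a assume "a \<in> leading_ideal (coefficientwise b c \<inter> graded_piece b n) (monomials b n) t"
  then obtain f g where fg: "Poly_Mapping.single t a = f + g" "f \<in> coefficientwise b c"
    "g \<in> poly_on {u \<in> monomials b n. u < t}" unfolding leading_ideal_def by blast
  have "t \<notin> Poly_Mapping.keys g" using fg(3) by (auto simp: poly_on_def)
  then have "Poly_Mapping.lookup g t = 0" by (simp add: in_keys_iff)
  then have "a = Poly_Mapping.lookup f t"
    using arg_cong[OF fg(1), of "\<lambda>p. Poly_Mapping.lookup p t"] by (simp add: lookup_add)
  then show "a \<in> c t" using fg(2) by (simp add: coefficientwise_def)
next
  fix a assume a: "a \<in> c t"
  have "Poly_Mapping.single t a \<in> coefficientwise b c \<inter> graded_piece b n"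
    using a t scalar.subspace_0[OF sub]
    by (auto simp: coefficientwise_def carrier_mpoly_ring lookup_single when_def graded_piece_eq monomials_def)
  moreover have "0 \<in> poly_on {u \<in> monomials b n. u < t}" by (simp add: poly_on_def)
  moreover have "Poly_Mapping.single t a = Poly_Mapping.single t a + 0" by simp
  ultimately show "a \<in> leading_ideal (coefficientwise b c \<inter> graded_piece b n) (monomials b n) t"
    unfolding leading_ideal_def by blast
qed

lemma hilbert_function_coefficientwise:
  "hilbert_function b (coefficientwise b c) n = (\<Sum>t\<in>monomials b n. interval_length (*) (c t) UNIV)"
  unfolding hilbert_function_eq_sum[OF ideal_coefficientwise]
  by (rule sum.cong) (simp_all add: leading_ideal_coefficientwise)

end

section \<open>Composition series and the weights for the converse\<close>

text \<open>A chain that attains the length leaves no slack: the lengths below and above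
  \<open>C i\<close> are at least \<open>i\<close> and \<open>l - i\<close>, and they add up to
  \<open>l\<close>.\<close>

lemma composition_series:
  assumes "interval_length (*) {0::'a::comm_ring_1} UNIV = enat l"
  obtains C :: "nat \<Rightarrow> 'a::comm_ring_1 set" where "\<And>i. i \<le> l \<Longrightarrow> scalar.subspace (C i)" "C 0 = {0}"
    "\<And>i j. i \<le> j \<Longrightarrow> j \<le> l \<Longrightarrow> C i \<subseteq> C j"
    "\<And>i. i \<le> l \<Longrightarrow> interval_length (*) (C i) UNIV = enat (l - i)"
proof -
  obtain C :: "nat \<Rightarrow> 'a set"
    where C: "\<And>i. i \<le> l \<Longrightarrow> C i \<in> {P. scalar.subspace P \<and> {0} \<subseteq> P \<and> P \<subseteq> UNIV}"
      and strict: "\<And>i. i < l \<Longrightarrow> C i \<subset> C (Suc i)"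
    by (rule chain_length_attained[OF assms[unfolded interval_length_def]])
      (use scalar.subspace_UNIV in blast)+
  have mono: "C i \<subseteq> C j" if "i \<le> j" "j \<le> l" for i j
    using that
  proof (induction j rule: dec_induct)
    case (step j)
    then show ?case using strict[of j] by auto
  qed simp
  have len: "interval_length (*) {0} (C i) = enat i \<and> interval_length (*) (C i) UNIV = enat (l - i)"
    if i: "i \<le> l" for i
  proof -
    have add: "enat l = interval_length (*) {0} (C i) + interval_length (*) (C i) UNIV"
      unfolding assms[symmetric] using C[OF i] by (intro scalar.interval_length_add) auto
    have "enat i \<le> interval_length (*) {0} (C i)"
      unfolding interval_length_def
      by (rule chain_length_ge[of i C]) (use C strict mono i in auto)
    moreover have "enat (l - i) \<le> interval_length (*) (C i) UNIV"
      unfolding interval_length_def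
      by (rule chain_length_ge[of "l - i" "\<lambda>j. C (i + j)"]) (use C strict mono i in auto)
    ultimately show ?thesis using add i
      by (cases "interval_length (*) {0} (C i)"; cases "interval_length (*) (C i) UNIV") auto
  qed
  have "C 0 = {0}"
  proof (rule ccontr)
    assume "C 0 \<noteq> {0}"
    then have "1 \<le> interval_length (*) {0} (C 0)"
      using C[of 0] by (intro scalar.interval_length_pos) auto
    then show False using len[of 0] by (simp add: one_enat_def)
  qed
  then show thesis using that[of C] C mono len by auto
qed

text \<open>\<open>binomial_up r n\<close> is less than the number of monomials of degree
  \<open>Suc n\<close>, so the growth condition forces \<open>q' \<le> q\<close>. A strict drop
  absorbs the indicator; for \<open>q' = q\<close> the condition reads
  \<open>r' \<le> binomial_up r n\<close>, and final segments are compared.\<close>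

lemma last_monomials_weight_mono:
  assumes "0 < b" and r: "r < card (monomials b n)" "r' < card (monomials b (Suc n))"
    and growth: "card (monomials b (Suc n)) * q' + r' \<le> card (monomials b (Suc n)) * q + binomial_up r n"
    and t: "t \<in> monomials b n" and "i < b"
  shows "q' + (if t + var i \<in> last_monomials b (Suc n) r' then 1 else 0)
           \<le> q + (if t \<in> last_monomials b n r then 1 else 0)"
proof -
  let ?N = "card (monomials b (Suc n))"
  have up: "binomial_up r n < ?N"
  proof (cases n)
    case 0
    then have "r = 0" using r by (simp add: monomials_0)
    then show ?thesis using r by (simp add: binomial_up_def)
  next
    case (Suc k)
    have "macaulay_op (Suc k) r < macaulay_op (Suc k) (card (monomials b (Suc k)))"
      using r(1) Suc strict_mono_macaulay_op by (simp add: strict_mono_less)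
    then show ?thesis using Suc by (simp add: binomial_up_eq macaulay_op_card_monomials)
  qed
  have "?N * q' < ?N * (q + 1)" using growth up by simp
  then have "q' < q + 1" using mult_less_cancel1[of ?N q' "q + 1"] by blast
  then have "q' \<le> q" by simp
  show ?thesis
  proof (cases "q' = q")
    case True
    have "t \<in> last_monomials b n r" if *: "t + var i \<in> last_monomials b (Suc n) r'"
    proof (cases n)
      case 0
      then have "r' = 0" using growth r True by (simp add: monomials_0 binomial_up_def)
      then have "card (last_monomials b (Suc n) r') = 0" by (simp add: card_last_monomials)
      moreover have "finite (last_monomials b (Suc n) r')"
        using last_monomials_subset finite_monomials by (rule finite_subset)
      ultimately show ?thesis using * by simp
    next
      case (Suc k)
      have "r' \<le> macaulay_op n r" using growth True Suc by (simp add: binomial_up_eq)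
      then have "t + var i \<in> last_monomials b (Suc n) (macaulay_op n r)"
        using * last_monomials_mono by blast
      then show ?thesis using last_monomials_divisor[of r b k t i] r Suc by simp
    qed
    then show ?thesis using True by simp
  qed (use \<open>q' \<le> q\<close> in auto)
qed

theorem theorem2p8:
  fixes m :: "'a::comm_ring_1 set"
    and H q r :: "nat \<Rightarrow> nat"
    and b :: nat
  assumes "local_ring_with (ring_of_type_algebra :: 'a ring) m"
    and "artinian_ring (ring_of_type_algebra :: 'a ring)"
    and "equicharacteristic (ring_of_type_algebra :: 'a ring) m"
    and "b \<ge> 1"
    and "\<And>n. H n = ((n + b - 1) choose (b - 1)) * q n + r n"
    and "\<And>n. r n < ((n + b - 1) choose (b - 1))"
  shows "(\<exists>I :: 'a mpoly set. homogeneous_ideal b I \<and> I \<subseteq> positive_part b \<and>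
            (\<forall>n. enat (H n) = hilbert_function b I n))
     \<longleftrightarrow>
     (enat (H 0) = module_length (ring_of_type_algebra :: 'a ring)
                     (regular_module (ring_of_type_algebra :: 'a ring)) \<and>
      (\<forall>n. H (n + 1) \<le> ((n + 1 + b - 1) choose (b - 1)) * q n + binomial_up (r n) n))"
proof -
  have b: "0 < b" using assms(4) by simp
  note N = card_monomials_eq_choose[OF b]
  have H: "H n = card (monomials b n) * q n + r n" and r: "r n < card (monomials b n)" for n
    using assms(5)[of n] assms(6)[of n] by (simp_all add: N)
  \<comment> \<open>Degree 0 has a single monomial, so division is by 1.\<close>
  have r0: "r 0 = 0" and q0: "q 0 = H 0" using r[of 0] H[of 0] by (simp_all add: monomials_0)
  have growth_iff: "H (n + 1) \<le> ((n + 1 + b - 1) choose (b - 1)) * q n + binomial_up (r n) n \<longleftrightarrow>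
      H (Suc n) \<le> card (monomials b (Suc n)) * q n + binomial_up (r n) n" for n
    by (simp add: N)
  let ?len = "interval_length (*) {0::'a} UNIV"
  have len: "module_length ring_of_type_algebra (regular_module (ring_of_type_algebra :: 'a ring)) = ?len"
    by (simp add: regular_module_eq scalar.module_length_UNIV)
  show ?thesis
    unfolding growth_iff len
  proof
    assume "\<exists>I :: 'a mpoly set. homogeneous_ideal b I \<and> I \<subseteq> positive_part b \<and>
            (\<forall>n. enat (H n) = hilbert_function b I n)"
    then obtain I :: "'a mpoly set" where I: "ideal I (mpoly_ring b)" "I \<subseteq> positive_part b"
      and hilb: "\<And>n. enat (H n) = hilbert_function b I n" by (auto simp: homogeneous_ideal_def)
    have "hilbert_function b I 0 = ?len"
      unfolding hilbert_function_eq_sum[OF I(1)]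
      using leading_ideal_0[OF I(2)] poly.subspace_0[OF subspace_ideal[OF I(1)]] by (simp add: monomials_0)
    \<comment> \<open>Since \<open>I\<close> meets degree 0 only in 0, the Hilbert function there is
      the length of the coefficient ring, which is therefore a natural number.\<close>
    then have H0: "enat (H 0) = ?len" using hilb by simp
    then have fin: "?len \<noteq> \<infinity>" by (metis enat.distinct(1))
    obtain h where h: "\<And>n. hilbert_function b I n = enat (sum h (monomials b n))"
      "\<And>n t i. t \<in> monomials b n \<Longrightarrow> i < b \<Longrightarrow> h (t + var i) \<le> h t"
      "enat (h 0) = ?len"
      by (rule hilbert_function_eq_sum_weights[OF I fin]) blast
    have Hh: "H n = sum h (monomials b n)" for n using hilb[of n] h(1)[of n] by simp
    have "H (Suc n) \<le> card (monomials b (Suc n)) * q n + binomial_up (r n) n" for n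
    proof (cases n)
      case 0
      \<comment> \<open>The weighted bound starts in degree 1. The passage from degree 0 to 1 only
        uses that no weight exceeds \<open>h 0\<close>, the length of the coefficient ring.\<close>
      have "h t \<le> q 0" if t: "t \<in> monomials b (Suc 0)" for t
      proof -
        obtain i u where "i < b" "t = u + var i" "u \<in> monomials b 0" using t by (rule monomials_SucE)
        then have "h t \<le> h 0" using h(2)[of u 0 i] by (simp add: monomials_0)
        also have "h 0 = q 0" using h(3) H0 q0 by (metis enat.inject)
        finally show ?thesis .
      qed
      then have "sum h (monomials b (Suc 0)) \<le> card (monomials b (Suc 0)) * q 0"
        using sum_bounded_above[of "monomials b (Suc 0)" h "q 0"] by simp
      then show ?thesis using 0 Hh by simp
    next
      case (Suc k)
      have "H (Suc n) \<le> graded_macaulay_op b n (H n)"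
        unfolding Hh Suc by (rule macaulay_bound_weighted[OF b]) (rule h(2))
      also have "graded_macaulay_op b n (H n) = card (monomials b (Suc n)) * q n + binomial_up (r n) n"
      proof -
        \<comment> \<open>Identifies the given \<open>q n\<close> and \<open>r n\<close> with the
          \<open>div\<close> and \<open>mod\<close> inside
          \<open>graded_macaulay_op\<close>.\<close>
        have "(d * x + y) div d = x \<and> (d * x + y) mod d = y" if "y < d" for d x y :: nat
          using that by simp
        from this[OF r[of n], of "q n"] show ?thesis
          unfolding graded_macaulay_op_def H[of n] using Suc by (simp only: binomial_up_eq)
      qed
      finally show ?thesis .
    qed
    then show "enat (H 0) = ?len \<and>
        (\<forall>n. H (Suc n) \<le> card (monomials b (Suc n)) * q n + binomial_up (r n) n)"
      using H0 by simp
  next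
    assume *: "enat (H 0) = ?len \<and>
        (\<forall>n. H (Suc n) \<le> card (monomials b (Suc n)) * q n + binomial_up (r n) n)"
    define l where "l = H 0"
    obtain C :: "nat \<Rightarrow> 'a set" where C: "\<And>i. i \<le> l \<Longrightarrow> scalar.subspace (C i)" "C 0 = {0}"
      "\<And>i j. i \<le> j \<Longrightarrow> j \<le> l \<Longrightarrow> C i \<subseteq> C j"
      "\<And>i. i \<le> l \<Longrightarrow> interval_length (*) (C i) UNIV = enat (l - i)"
      by (rule composition_series[of l]) (use * in \<open>auto simp: l_def\<close>)
    define h where
      "h t = q (monom_degree t) + (if t \<in> last_monomials b (monom_degree t) (r (monom_degree t)) then 1 else 0)" for t
    have h_mono: "h (t + var i) \<le> h t" if "Poly_Mapping.keys t \<subseteq> {..<b}" "i < b" for t i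
    proof -
      define n where "n = monom_degree t"
      have t: "t \<in> monomials b n" using that by (simp add: monomials_def n_def)
      have "card (monomials b (Suc n)) * q (Suc n) + r (Suc n)
              \<le> card (monomials b (Suc n)) * q n + binomial_up (r n) n"
        using * H[of "Suc n"] by metis
      from last_monomials_weight_mono[OF b r r this t \<open>i < b\<close>]
      show ?thesis by (simp add: h_def n_def)
    qed
    have h0: "h 0 = l" by (simp add: h_def r0 q0 l_def)
    have h_le: "h t \<le> l" if "t \<in> monomials b n" for n t
      using that
    proof (induction n arbitrary: t)
      case 0
      then show ?case by (simp add: monomials_0 h0)
    next
      case (Suc n)
      obtain i u where u: "i < b" "t = u + var i" "u \<in> monomials b n" using Suc.prems by (rule monomials_SucE)
      then show ?case using Suc.IH[of u] h_mono[of u i] by (auto simp: monomials_def)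
    qed
    \<comment> \<open>The index is chosen so that the colength of \<open>c t\<close> is
      \<open>h t\<close>. At the monomial 1 it gives \<open>c 0 = C 0 = {0}\<close>, which keeps
      constant terms out of the ideal.\<close>
    define c where "c t = C (l - h t)" for t
    have sub: "scalar.subspace (c t)" for t by (simp add: c_def C(1))
    have mono: "c t \<subseteq> c (t + var i)" if "Poly_Mapping.keys t \<subseteq> {..<b}" "i < b" for t i
      unfolding c_def using h_mono[OF that] by (intro C(3)) auto
    have "coefficientwise b c \<subseteq> positive_part b"
    proof
      fix p assume p: "p \<in> coefficientwise b c"
      then have "Poly_Mapping.lookup p 0 \<in> c 0" by (simp add: coefficientwise_def)
      then have "Poly_Mapping.lookup p 0 = 0" by (simp add: c_def h0 C(2))
      then have "t \<noteq> 0" if "t \<in> Poly_Mapping.keys p" for t using that by (auto simp: in_keys_iff)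
      then have "1 \<le> monom_degree t" if "t \<in> Poly_Mapping.keys p" for t
        using that monom_degree_eq_0_iff[of t] by fastforce
      then show "p \<in> positive_part b" using p by (simp add: positive_part_def coefficientwise_def)
    qed
    moreover have "enat (H n) = hilbert_function b (coefficientwise b c) n" for n
    proof -
      have "interval_length (*) (c t) UNIV = enat (h t)" if "t \<in> monomials b n" for t
        \<comment> \<open>\<open>h t \<le> l\<close> is essential: it makes the truncated difference
          \<open>l - (l - h t)\<close> equal to \<open>h t\<close>.\<close>
        unfolding c_def using C(4)[of "l - h t"] h_le[OF that] by simp
      then have "(\<Sum>t\<in>monomials b n. interval_length (*) (c t) UNIV) = (\<Sum>t\<in>monomials b n. enat (h t))"
        by (rule sum.cong[OF refl])
      moreover have "hilbert_function b (coefficientwise b c) n =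
          (\<Sum>t\<in>monomials b n. interval_length (*) (c t) UNIV)"
        by (rule hilbert_function_coefficientwise) (fact sub, fact mono)
      ultimately have "hilbert_function b (coefficientwise b c) n = (\<Sum>t\<in>monomials b n. enat (h t))"
        by simp
      also have "\<dots> = enat (sum h (monomials b n))" by (simp flip: of_nat_eq_enat)
      also have "sum h (monomials b n) =
          (\<Sum>t\<in>monomials b n. q n + (if t \<in> last_monomials b n (r n) then 1 else 0))"
        by (rule sum.cong) (auto simp: h_def monomials_def)
      also have "\<dots> = card (monomials b n) * q n + card (monomials b n \<inter> last_monomials b n (r n))"
        by (simp add: sum.distrib sum.If_cases Int_def)
      also have "monomials b n \<inter> last_monomials b n (r n) = last_monomials b n (r n)"
        using last_monomials_subset by blast
      also have "card (last_monomials b n (r n)) = r n" using r[of n] by (simp add: card_last_monomials)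
      finally show ?thesis using H[of n] by simp
    qed
    moreover have "homogeneous_ideal b (coefficientwise b c)"
      by (rule homogeneous_ideal_coefficientwise) (fact sub, fact mono)
    ultimately show "\<exists>I :: 'a mpoly set. homogeneous_ideal b I \<and> I \<subseteq> positive_part b \<and>
            (\<forall>n. enat (H n) = hilbert_function b I n)"
      by blast
  qed
qed

end
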